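(* Let $X$ be an infinite dimensional separable Banach space and $(S,\Sigma,\nu)$ a $\sigma$-finite measure space. Suppose that $\mathfrak{U}\subseteq\mathcal{L}(X)$ is a closed standard algebra and that $\mathfrak{A}\subseteq L_0^{wo}(\nu;\mathcal{L}(X))$ is a $\mathfrak{U}$-admissible subalgebra. If $\delta:\mathfrak{A}\to\mathfrak{A}$ is a derivation, then there exists $w\in L_0^{wo}(\nu;\mathcal{L}(X))$ such that $\delta(f)=wf-fw$ for all $f\in\mathfrak{A}$.
   Context: Banach spaces are complex; measure spaces are assumed complete. $L_0(\nu)$ (resp. $L_\infty(\nu)$) is the algebra of $\nu$-a.e. equivalence classes of $\nu$-measurable (resp. essentially bounded $\nu$-measurable) complex functions. $\mathcal{L}(X)$ is the algebra of bounded linear operators on $X$ (identity $\mathbf 1$) and $\mathcal{F}(X)$ the subalgebra of finite rank operators. $\mathcal{I}(\mathcal{F}(X))=\{p\in\mathcal{F}(X):p^2=p\}$ and $p^\perp=\mathbf 1-p$. For $X$ separable, $f:S\to\mathcal{L}(X)$ is weak operator $\nu$-measurable if $s\mapsto\langle f(s)x,x^*\rangle$ is $\nu$-measurable for all $x\in X$, $x^*\in X^*$. For a closed subspace $\mathfrak{B}\subseteq\mathcal{L}(X)$, $L_0^{wo}(\nu;\mathfrak{B})$ is the space of $\nu$-a.e. equivalence classes of weak operator $\nu$-measurable functions $S\to\mathfrak{B}$, and $L_\infty^{wo}(\nu;\mathfrak{B})$ the subspace of essentially bounded ones, with norm $\|f\|_\infty=\operatorname{ess\,sup}_s\|f(s)\|$.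 With pointwise multiplication $L_0^{wo}(\nu;\mathcal{L}(X))$ is a unital algebra; it is an $L_0(\nu)$-module via $(af)(s)=a(s)f(s)$. $\mathbf 1\otimes T$ denotes the constant function $s\mapsto T$, and $\chi_A$ is the indicator function of $A$. A subalgebra $\mathfrak{U}$ of $\mathcal{L}(X)$ is standard if $\mathcal{F}(X)\subseteq\mathfrak{U}$; closed means norm closed. For a closed standard algebra $\mathfrak{U}$, a subalgebra $\mathfrak{A}$ of $L_0^{wo}(\nu;\mathcal{L}(X))$ is $\mathfrak{U}$-admissible if: (i) $\mathfrak{A}\subseteq L_0^{wo}(\nu;\mathfrak{U})$ and $gf\in\mathfrak{A}$ whenever $g\in L_\infty(\nu)$, $f\in\mathfrak{A}$; (ii) if $f\in L_\infty^{wo}(\nu;\mathcal{L}(X))$ and for every $\varepsilon>0$ there is $p\in\mathcal{I}(\mathcal{F}(X))$ with $\|f(\mathbf 1\otimes p^\perp)\|_\infty\le\varepsilon$, then $\chi_Af\in\mathfrak{A}$ for all $\nu$-measurable $A\subseteq S$ with $\nu(A)<\infty$; (iii) for every $f\in L_0^{wo}(\nu;\mathfrak{U})$ there is a $\nu$-measurable partition $\{A_n\}_{n=1}^\infty$ of $S$ with $\chi_{A_n}f\in\mathfrak{A}$ for all $n$. A derivation on an algebra $A$ is a linear map $\delta:A\to A$ with $\delta(xy)=\delta(x)y+x\delta(y)$ for all $x,y\in A$. *)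

theory Defs
  imports "HOL-Analysis.Analysis" "HOL-Probability.Essential_Supremum"
begin

section \<open>Complex Banach spaces and bounded operators\<close>

text \<open>
  The library has only real normed spaces as a type class. A complex Banach space is a (real)
  Banach space with a compatible complex scalar multiplication and a complex-homogeneous norm.
\<close>

class complex_banach = banach +
  fixes scaleC :: "complex \<Rightarrow> 'a \<Rightarrow> 'a" (infixr "*\<^sub>C" 75)
  assumes scaleC_add_right: "a *\<^sub>C (x + y) = a *\<^sub>C x + a *\<^sub>C y"
    and scaleC_add_left: "(a + b) *\<^sub>C x = a *\<^sub>C x + b *\<^sub>C x"
    and scaleC_scaleC: "a *\<^sub>C b *\<^sub>C x = (a * b) *\<^sub>C x"
    and scaleC_one: "1 *\<^sub>C x = x"
    and scaleC_of_real: "complex_of_real r *\<^sub>C x = r *\<^sub>R x"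
    and norm_scaleC: "norm (a *\<^sub>C x) = cmod a * norm x"

global_interpretation complex_vector:
  vector_space "scaleC :: complex \<Rightarrow> 'a \<Rightarrow> 'a::complex_banach"
  by unfold_locales (rule scaleC_add_right scaleC_add_left scaleC_scaleC scaleC_one)+

instantiation complex :: complex_banach
begin

definition scaleC_complex :: "complex \<Rightarrow> complex \<Rightarrow> complex"
  where "scaleC_complex a x = a * x"

instance
  by standard (simp_all add: scaleC_complex_def algebra_simps norm_mult scaleR_conv_of_real)

end

lemma bounded_linear_scaleC: "bounded_linear (\<lambda>x::'a::complex_banach. c *\<^sub>C x)"
proof (rule bounded_linear_intro)
  fix x y :: 'a and r :: real
  show "c *\<^sub>C (x + y) = c *\<^sub>C x + c *\<^sub>C y"
    by (rule scaleC_add_right)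
  show "c *\<^sub>C r *\<^sub>R x = r *\<^sub>R c *\<^sub>C x"
    by (metis scaleC_of_real scaleC_scaleC mult.commute)
  show "norm (c *\<^sub>C x) \<le> norm x * cmod c"
    by (simp add: norm_scaleC mult.commute)
qed

instantiation blinfun :: (real_normed_vector, complex_banach) complex_banach
begin

definition scaleC_blinfun :: "complex \<Rightarrow> 'a \<Rightarrow>\<^sub>L 'b \<Rightarrow> 'a \<Rightarrow>\<^sub>L 'b"
  where "scaleC_blinfun c T = Blinfun (\<lambda>x. c *\<^sub>C blinfun_apply T x)"

lemma scaleC_blinfun_apply: "blinfun_apply (c *\<^sub>C T) x = c *\<^sub>C blinfun_apply T x"
  for T :: "'a \<Rightarrow>\<^sub>L 'b"
  unfolding scaleC_blinfun_def
  by (subst bounded_linear_Blinfun_apply)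
     (auto intro!: bounded_linear_compose[OF bounded_linear_scaleC] blinfun.bounded_linear_right)

instance
proof
  fix a b :: complex and r :: real and S T :: "'a \<Rightarrow>\<^sub>L 'b"
  show "a *\<^sub>C (S + T) = a *\<^sub>C S + a *\<^sub>C T"
    by (rule blinfun_eqI) (simp add: scaleC_blinfun_apply blinfun.add_left scaleC_add_right)
  show "(a + b) *\<^sub>C T = a *\<^sub>C T + b *\<^sub>C T"
    by (rule blinfun_eqI) (simp add: scaleC_blinfun_apply blinfun.add_left scaleC_add_left)
  show "a *\<^sub>C b *\<^sub>C T = (a * b) *\<^sub>C T"
    by (rule blinfun_eqI) (simp add: scaleC_blinfun_apply scaleC_scaleC)
  show one: "1 *\<^sub>C T = T" for T :: "'a \<Rightarrow>\<^sub>L 'b"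
    by (rule blinfun_eqI) (simp add: scaleC_blinfun_apply scaleC_one)
  show "complex_of_real r *\<^sub>C T = r *\<^sub>R T"
    by (rule blinfun_eqI) (simp add: scaleC_blinfun_apply blinfun.scaleR_left scaleC_of_real)
  have le: "norm (c *\<^sub>C U) \<le> cmod c * norm U" for c and U :: "'a \<Rightarrow>\<^sub>L 'b"
    by (rule norm_blinfun_bound)
       (auto simp: scaleC_blinfun_apply norm_scaleC mult.assoc intro!: mult_left_mono norm_blinfun)
  show "norm (a *\<^sub>C T) = cmod a * norm T"
  proof (cases "a = 0")
    case True
    then show ?thesis using le[of a T] by simp
  next
    case False
    have "T = inverse a *\<^sub>C a *\<^sub>C T"
      by (rule blinfun_eqI) (simp add: scaleC_blinfun_apply scaleC_scaleC scaleC_one False)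
    then have "norm T \<le> cmod (inverse a) * norm (a *\<^sub>C T)"
      using le[of "inverse a" "a *\<^sub>C T"] by simp
    then have "cmod a * norm T \<le> norm (a *\<^sub>C T)"
      using False by (simp add: norm_divide field_simps)
    then show ?thesis using le[of a T] by simp
  qed
qed

end

text \<open>
  The library type \<^typ>\<open>'a \<Rightarrow>\<^sub>L 'b\<close> consists of the bounded \<^emph>\<open>real\<close>-linear operators;
  the complex-linear ones have to be selected from it. The operator norm is the same.
\<close>

definition bounded_ops :: "('a::complex_banach \<Rightarrow>\<^sub>L 'b::complex_banach) set" where
  "bounded_ops = {T. \<forall>c x. blinfun_apply T (c *\<^sub>C x) = c *\<^sub>C blinfun_apply T x}"

definition infinite_dimensional :: "'a::complex_banach itself \<Rightarrow> bool" where
  "infinite_dimensional _ \<longleftrightarrow> \<not> (\<exists>B::'a set. finite B \<and> complex_vector.span B = UNIV)"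

definition finite_rank_ops :: "('a::complex_banach \<Rightarrow>\<^sub>L 'a) set" where
  "finite_rank_ops =
    {T \<in> bounded_ops. \<exists>B. finite B \<and> range (blinfun_apply T) = complex_vector.span B}"

definition finite_rank_idempotents :: "('a::complex_banach \<Rightarrow>\<^sub>L 'a) set" where
  "finite_rank_idempotents = {p \<in> finite_rank_ops. p o\<^sub>L p = p}"

definition operator_subalgebra :: "('a::complex_banach \<Rightarrow>\<^sub>L 'a) set \<Rightarrow> bool" where
  "operator_subalgebra U \<longleftrightarrow>
    U \<subseteq> bounded_ops \<and> complex_vector.subspace U \<and> (\<forall>S\<in>U. \<forall>T\<in>U. S o\<^sub>L T \<in> U)"

definition closed_standard_algebra :: "('a::complex_banach \<Rightarrow>\<^sub>L 'a) set \<Rightarrow> bool" where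
  "closed_standard_algebra U \<longleftrightarrow> operator_subalgebra U \<and> finite_rank_ops \<subseteq> U \<and> closed U"


section \<open>Spaces of almost everywhere equivalence classes\<close>

text \<open>
  Measure spaces are complete in all that follows. Functions are total on the type \<^typ>\<open>'s\<close>, but
  neither measurability nor equality almost everywhere depends on values outside \<open>space M\<close>.
\<close>

definition ae_rel :: "'s measure \<Rightarrow> ('s \<Rightarrow> 'b) set \<Rightarrow> (('s \<Rightarrow> 'b) \<times> ('s \<Rightarrow> 'b)) set" where
  "ae_rel M C = {(f, g). f \<in> C \<and> g \<in> C \<and> (AE s in M. f s = g s)}"

lemma equiv_ae_rel: "equiv C (ae_rel M C)"
  by (rule equivI) (auto simp: ae_rel_def refl_on_def sym_def trans_def elim: eventually_elim2 eventually_mono)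

definition ess_norm :: "'s measure \<Rightarrow> ('s \<Rightarrow> 'b::real_normed_vector) set \<Rightarrow> ereal" where
  "ess_norm M F = the_elem ((\<lambda>f. esssup M (\<lambda>s. ereal (norm (f s)))) ` F)"

definition L0 :: "'s measure \<Rightarrow> ('s \<Rightarrow> complex) set set" where
  "L0 M = borel_measurable M // ae_rel M (borel_measurable M)"

definition L0_class :: "'s measure \<Rightarrow> ('s \<Rightarrow> complex) \<Rightarrow> ('s \<Rightarrow> complex) set" where
  "L0_class M g = ae_rel M (borel_measurable M) `` {g}"

definition Linf :: "'s measure \<Rightarrow> ('s \<Rightarrow> complex) set set" where
  "Linf M = {G \<in> L0 M. ess_norm M G < \<infinity>}"

definition wo_measurable :: "'s measure \<Rightarrow> ('s \<Rightarrow> 'a::complex_banach \<Rightarrow>\<^sub>L 'a) set" where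
  "wo_measurable M =
    {f \<in> space M \<rightarrow> bounded_ops.
      \<forall>x. \<forall>\<phi>\<in>(bounded_ops :: ('a \<Rightarrow>\<^sub>L complex) set).
        (\<lambda>s. blinfun_apply \<phi> (blinfun_apply (f s) x)) \<in> borel_measurable M}"

definition wo_class ::
    "'s measure \<Rightarrow> ('s \<Rightarrow> 'a::complex_banach \<Rightarrow>\<^sub>L 'a) \<Rightarrow> ('s \<Rightarrow> 'a \<Rightarrow>\<^sub>L 'a) set" where
  "wo_class M f = ae_rel M (wo_measurable M) `` {f}"

text \<open>
  A class in \<open>L0_wo M B\<close> is regarded as a class of operator-valued functions that has a
  representative with values in \<open>B\<close>, so that \<open>L0_wo M B \<subseteq> L0_wo M bounded_ops\<close>.
\<close>

definition L0_wo ::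
    "'s measure \<Rightarrow> ('a::complex_banach \<Rightarrow>\<^sub>L 'a) set \<Rightarrow> ('s \<Rightarrow> 'a \<Rightarrow>\<^sub>L 'a) set set" where
  "L0_wo M B = wo_class M ` {f \<in> wo_measurable M. f \<in> space M \<rightarrow> B}"

lemma L0_wo_bounded_ops: "L0_wo M bounded_ops = wo_measurable M // ae_rel M (wo_measurable M)"
  by (auto simp: L0_wo_def wo_class_def quotient_def wo_measurable_def)

definition Linf_wo ::
    "'s measure \<Rightarrow> ('a::complex_banach \<Rightarrow>\<^sub>L 'a) set \<Rightarrow> ('s \<Rightarrow> 'a \<Rightarrow>\<^sub>L 'a) set set" where
  "Linf_wo M B = {F \<in> L0_wo M B. ess_norm M F < \<infinity>}"


section \<open>The algebra of weak operator measurable functions\<close>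

text \<open>
  Pointwise operations on classes. The union over representatives is the class of any single
  choice, because on a separable space the pointwise results are again weak operator measurable.
\<close>

definition wo_lift2 ::
    "'s measure \<Rightarrow> ('b \<Rightarrow> 'c \<Rightarrow> 'a::complex_banach \<Rightarrow>\<^sub>L 'a) \<Rightarrow>
     ('s \<Rightarrow> 'b) set \<Rightarrow> ('s \<Rightarrow> 'c) set \<Rightarrow> ('s \<Rightarrow> 'a \<Rightarrow>\<^sub>L 'a) set" where
  "wo_lift2 M op F G = (\<Union>f\<in>F. \<Union>g\<in>G. wo_class M (\<lambda>s. op (f s) (g s)))"

definition wo_add ::
    "'s measure \<Rightarrow> ('s \<Rightarrow> 'a::complex_banach \<Rightarrow>\<^sub>L 'a) set \<Rightarrow>
     ('s \<Rightarrow> 'a \<Rightarrow>\<^sub>L 'a) set \<Rightarrow> ('s \<Rightarrow> 'a \<Rightarrow>\<^sub>L 'a) set" where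
  "wo_add M = wo_lift2 M (+)"

definition wo_diff ::
    "'s measure \<Rightarrow> ('s \<Rightarrow> 'a::complex_banach \<Rightarrow>\<^sub>L 'a) set \<Rightarrow>
     ('s \<Rightarrow> 'a \<Rightarrow>\<^sub>L 'a) set \<Rightarrow> ('s \<Rightarrow> 'a \<Rightarrow>\<^sub>L 'a) set" where
  "wo_diff M = wo_lift2 M (-)"

definition wo_mult ::
    "'s measure \<Rightarrow> ('s \<Rightarrow> 'a::complex_banach \<Rightarrow>\<^sub>L 'a) set \<Rightarrow>
     ('s \<Rightarrow> 'a \<Rightarrow>\<^sub>L 'a) set \<Rightarrow> ('s \<Rightarrow> 'a \<Rightarrow>\<^sub>L 'a) set" where
  "wo_mult M = wo_lift2 M (o\<^sub>L)"

definition wo_smult ::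
    "'s measure \<Rightarrow> ('s \<Rightarrow> complex) set \<Rightarrow>
     ('s \<Rightarrow> 'a::complex_banach \<Rightarrow>\<^sub>L 'a) set \<Rightarrow> ('s \<Rightarrow> 'a \<Rightarrow>\<^sub>L 'a) set" where
  "wo_smult M = wo_lift2 M scaleC"

definition wo_scale ::
    "'s measure \<Rightarrow> complex \<Rightarrow>
     ('s \<Rightarrow> 'a::complex_banach \<Rightarrow>\<^sub>L 'a) set \<Rightarrow> ('s \<Rightarrow> 'a \<Rightarrow>\<^sub>L 'a) set" where
  "wo_scale M c = wo_smult M (L0_class M (\<lambda>_. c))"

definition wo_const :: "'s measure \<Rightarrow> ('a::complex_banach \<Rightarrow>\<^sub>L 'a) \<Rightarrow> ('s \<Rightarrow> 'a \<Rightarrow>\<^sub>L 'a) set" where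
  "wo_const M T = wo_class M (\<lambda>_. T)"

definition char_class :: "'s measure \<Rightarrow> 's set \<Rightarrow> ('s \<Rightarrow> complex) set" where
  "char_class M A = L0_class M (indicator A)"

definition wo_subalgebra :: "'s measure \<Rightarrow> ('s \<Rightarrow> 'a::complex_banach \<Rightarrow>\<^sub>L 'a) set set \<Rightarrow> bool" where
  "wo_subalgebra M \<AA> \<longleftrightarrow>
    \<AA> \<subseteq> L0_wo M bounded_ops \<and>
    wo_const M 0 \<in> \<AA> \<and>
    (\<forall>F\<in>\<AA>. \<forall>G\<in>\<AA>. wo_add M F G \<in> \<AA>) \<and>
    (\<forall>c. \<forall>F\<in>\<AA>. wo_scale M c F \<in> \<AA>) \<and>
    (\<forall>F\<in>\<AA>. \<forall>G\<in>\<AA>. wo_mult M F G \<in> \<AA>)"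

text \<open>
  Pieces of the partition in the last clause may be empty, as they must be when \<open>space M\<close> is finite.
\<close>

definition admissible ::
    "'s measure \<Rightarrow> ('a::complex_banach \<Rightarrow>\<^sub>L 'a) set \<Rightarrow> ('s \<Rightarrow> 'a \<Rightarrow>\<^sub>L 'a) set set \<Rightarrow> bool" where
  "admissible M U \<AA> \<longleftrightarrow>
    wo_subalgebra M \<AA> \<and>
    (\<AA> \<subseteq> L0_wo M U \<and> (\<forall>G\<in>Linf M. \<forall>F\<in>\<AA>. wo_smult M G F \<in> \<AA>)) \<and>
    (\<forall>F\<in>Linf_wo M bounded_ops.
      (\<forall>\<epsilon>::real. \<epsilon> > 0 \<longrightarrow>
        (\<exists>p\<in>finite_rank_idempotents.
          ess_norm M (wo_mult M F (wo_const M (id_blinfun - p))) \<le> ereal \<epsilon>)) \<longrightarrow>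
      (\<forall>A\<in>sets M. emeasure M A < \<infinity> \<longrightarrow> wo_smult M (char_class M A) F \<in> \<AA>)) \<and>
    (\<forall>F\<in>L0_wo M U. \<exists>A::nat \<Rightarrow> 's set.
      range A \<subseteq> sets M \<and> disjoint_family A \<and> (\<Union>n. A n) = space M \<and>
      (\<forall>n. wo_smult M (char_class M (A n)) F \<in> \<AA>))"

text \<open>Only the values of \<open>\<delta>\<close> on \<open>\<AA>\<close> matter.\<close>

definition wo_derivation ::
    "'s measure \<Rightarrow> ('s \<Rightarrow> 'a::complex_banach \<Rightarrow>\<^sub>L 'a) set set \<Rightarrow>
     (('s \<Rightarrow> 'a \<Rightarrow>\<^sub>L 'a) set \<Rightarrow> ('s \<Rightarrow> 'a \<Rightarrow>\<^sub>L 'a) set) \<Rightarrow> bool" where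
  "wo_derivation M \<AA> \<delta> \<longleftrightarrow>
    \<delta> \<in> \<AA> \<rightarrow> \<AA> \<and>
    (\<forall>F\<in>\<AA>. \<forall>G\<in>\<AA>. \<delta> (wo_add M F G) = wo_add M (\<delta> F) (\<delta> G)) \<and>
    (\<forall>c. \<forall>F\<in>\<AA>. \<delta> (wo_scale M c F) = wo_scale M c (\<delta> F)) \<and>
    (\<forall>F\<in>\<AA>. \<forall>G\<in>\<AA>. \<delta> (wo_mult M F G) = wo_add M (wo_mult M (\<delta> F) G) (wo_mult M F (\<delta> G)))"

end

theory Submission
  imports Defs
begin

text \<open>
  The argument runs on representatives, that is, on operator-valued functions \<open>f\<close> whose class lies
  in \<open>\<AA>\<close>, with \<open>d f\<close> a representative of the image under \<open>\<delta>\<close>. For a vector \<open>y\<close> and a functional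
  \<open>\<phi>\<close> let \<open>y \<otimes> \<phi>\<close> be the rank one operator sending \<open>v\<close> to \<open>\<phi>(v) y\<close>. Fix \<open>e\<close> and \<open>\<phi>\<close> with
  \<open>\<phi>(e) = 1\<close> and a measurable set \<open>A\<close> of finite measure. For every bounded measurable field of vectors
  \<open>y\<close> the function \<open>\<chi>\<^sub>A (y \<otimes> \<phi>)\<close> belongs to the algebra, so \<open>W y = d (\<chi>\<^sub>A (y \<otimes> \<phi>)) e\<close> makes sense. The
  Leibniz rule for the product \<open>f \<cdot> \<chi>\<^sub>A (y \<otimes> \<phi>) = \<chi>\<^sub>A (f y \<otimes> \<phi>)\<close>, evaluated at \<open>e\<close>, reads
  \<open>W (f y) = d f y + f (W y)\<close> on \<open>A\<close>. Hence \<open>d f\<close> is the commutator of \<open>W\<close> and \<open>f\<close>, and what remains is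
  to see that \<open>W\<close> acts as multiplication by a measurable field of bounded operators. There are two
  obstacles.

  First, \<open>W\<close> is complex linear, but linearity over functions can fail: what one gets directly is
  \<open>W (b x) = b (W x) + D(b) x\<close> for a scalar function \<open>b\<close> and a constant vector \<open>x\<close>. In finite
  dimensions \<open>D\<close> can be nonzero, because \<open>L\<^sub>0\<close> itself may carry nonzero derivations. It is here that infinite
  dimension enters (lemma \<open>D_eq_0\<close>). Since \<open>d\<close> is local, \<open>D\<close> vanishes on countably valued functions, so
  \<open>D(a) = D(b\<^sub>n)\<close> for functions \<open>b\<^sub>n\<close> that are uniformly as small as desired. Take a biorthogonal system
  \<open>x\<^sub>n, \<xi>\<^sub>n\<close>, put \<open>\<nu>\<^sub>n = \<parallel>x\<^sub>n\<parallel> \<parallel>\<xi>\<^sub>n\<parallel>\<close>, and form the diagonal operators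
  \<open>g = \<Sum>\<^sub>n (n + 1) \<nu>\<^sub>n b\<^sub>n (x\<^sub>n \<otimes> \<xi>\<^sub>n)\<close>. When the \<open>b\<^sub>n\<close> are small enough the series converges in norm
  uniformly, so \<open>\<chi>\<^sub>A g\<close> belongs to the algebra; its image has diagonal entries
  \<open>(n + 1) \<nu>\<^sub>n D(a)\<close>, and a bounded operator can have these at a point only if \<open>D(a)\<close> vanishes there.

  Second, the operators have to be bounded at almost every point. Once \<open>D = 0\<close>, a norming sequence of
  functionals \<open>\<psi>\<^sub>j\<close> satisfies \<open>\<psi>\<^sub>j(W y (s)) = l\<^sub>j(s)(y(s))\<close> with bounded functionals \<open>l\<^sub>j(s)\<close>. If the
  norms of the \<open>l\<^sub>j(s)\<close> were unbounded on a set of positive measure, then a gliding hump carried out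
  measurably in \<open>s\<close> (lemma \<open>measurable_gliding_hump\<close>) would give a field \<open>y\<close> for which the left-hand side is
  unbounded in \<open>j\<close>, although it is at most \<open>\<parallel>W y (s)\<parallel>\<close>. A bound on the norms is exactly what is
  required for the \<open>l\<^sub>j(s)\<close> to come from one bounded operator \<open>w(s)\<close>.

  The operators obtained on the pieces of a countable cover of the measure space by sets of finite measure
  are finally glued.
\<close>

section \<open>Norming functionals\<close>

definition sublinear :: "('a::real_vector \<Rightarrow> real) \<Rightarrow> bool" where
  "sublinear q \<longleftrightarrow> (\<forall>x y. q (x + y) \<le> q x + q y) \<and> (\<forall>t x. 0 \<le> t \<longrightarrow> q (t *\<^sub>R x) \<le> t * q x)"

lemma sublinear_add: "sublinear q \<Longrightarrow> q (x + y) \<le> q x + q y"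
  and sublinear_scaleR_le: "sublinear q \<Longrightarrow> 0 \<le> t \<Longrightarrow> q (t *\<^sub>R x) \<le> t * q x"
  by (auto simp: sublinear_def)

lemma sublinear_0:
  assumes "sublinear q" shows "q 0 = 0"
  using sublinear_add[OF assms, of 0 0] sublinear_scaleR_le[OF assms, of 0 0] by simp

lemma sublinear_scaleR:
  assumes q: "sublinear q" and t: "0 \<le> t"
  shows "q (t *\<^sub>R x) = t * q x"
proof (cases "t = 0")
  case True
  then show ?thesis by (simp add: sublinear_0[OF q])
next
  case False
  with t have "0 < t" by simp
  have "q x = q (inverse t *\<^sub>R t *\<^sub>R x)" using False by simp
  also have "\<dots> \<le> inverse t * q (t *\<^sub>R x)"
    using \<open>0 < t\<close> by (intro sublinear_scaleR_le[OF q]) simp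
  finally have "t * q x \<le> q (t *\<^sub>R x)"
    using \<open>0 < t\<close> by (simp add: field_simps)
  then show ?thesis using sublinear_scaleR_le[OF q t, of x] by simp
qed

lemma sublinear_minus: "sublinear q \<Longrightarrow> - q (- x) \<le> q x"
  using sublinear_add[of q x "- x"] by (simp add: sublinear_0)

text \<open>
  The largest sublinear functional below \<open>q\<close> that takes the value \<open>- q y\<close> at \<open>- y\<close>. A minimal
  sublinear functional cannot be lowered, so it is additive; lowering the norm before minimising
  is what forces the resulting linear functional to attain the norm at a given vector.
\<close>

definition lowered :: "('a::real_vector \<Rightarrow> real) \<Rightarrow> 'a \<Rightarrow> 'a \<Rightarrow> real" where
  "lowered q y x = (INF t\<in>{0..}. q (x + t *\<^sub>R y) - t * q y)"

lemma lowered_bdd: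
  assumes q: "sublinear q"
  shows "bdd_below ((\<lambda>t. q (x + t *\<^sub>R y) - t * q y) ` {0..})"
proof (rule bdd_belowI2)
  fix t :: real assume "t \<in> {0..}"
  then have t: "0 \<le> t" by simp
  have "t * q y = q ((x + t *\<^sub>R y) + (- x))"
    using sublinear_scaleR[OF q t, of y] by simp
  also have "\<dots> \<le> q (x + t *\<^sub>R y) + q (- x)" by (rule sublinear_add[OF q])
  finally show "- q (- x) \<le> q (x + t *\<^sub>R y) - t * q y" by simp
qed

lemma lowered_le:
  assumes "sublinear q" "0 \<le> t"
  shows "lowered q y x \<le> q (x + t *\<^sub>R y) - t * q y"
  unfolding lowered_def using assms by (intro cINF_lower lowered_bdd) auto

lemma lowered_greatest:
  assumes "\<And>t. 0 \<le> t \<Longrightarrow> a \<le> q (x + t *\<^sub>R y) - t * q y"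
  shows "a \<le> lowered q y x"
  unfolding lowered_def using assms by (intro cINF_greatest) auto

lemma sublinear_lowered:
  assumes q: "sublinear q"
  shows "sublinear (lowered q y)"
  unfolding sublinear_def
proof safe
  fix x z
  have *: "lowered q y (x + z) \<le> (q (x + t *\<^sub>R y) - t * q y) + (q (z + u *\<^sub>R y) - u * q y)"
    if "0 \<le> t" "0 \<le> u" for t u
  proof -
    have "lowered q y (x + z) \<le> q (x + z + (t + u) *\<^sub>R y) - (t + u) * q y"
      using that by (intro lowered_le q) auto
    also have "x + z + (t + u) *\<^sub>R y = (x + t *\<^sub>R y) + (z + u *\<^sub>R y)" by (simp add: algebra_simps)
    also have "q \<dots> \<le> q (x + t *\<^sub>R y) + q (z + u *\<^sub>R y)" by (rule sublinear_add[OF q])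
    finally show ?thesis by (simp add: algebra_simps)
  qed
  have "lowered q y (x + z) - (q (x + t *\<^sub>R y) - t * q y) \<le> lowered q y z" if "0 \<le> t" for t
    using *[OF that] by (intro lowered_greatest) (simp add: algebra_simps)
  then have "lowered q y (x + z) - lowered q y z \<le> lowered q y x"
    by (intro lowered_greatest) (simp add: algebra_simps)
  then show "lowered q y (x + z) \<le> lowered q y x + lowered q y z" by simp
next
  fix c :: real and x assume "0 \<le> c"
  show "lowered q y (c *\<^sub>R x) \<le> c * lowered q y x"
  proof (cases "c = 0")
    case True
    then show ?thesis using lowered_le[OF q order_refl, of y 0] by (simp add: sublinear_0[OF q])
  next
    case False
    with \<open>0 \<le> c\<close> have c: "0 < c" by simp
    have "lowered q y (c *\<^sub>R x) / c \<le> q (x + t *\<^sub>R y) - t * q y" if "0 \<le> t" for t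
    proof -
      have "lowered q y (c *\<^sub>R x) \<le> q (c *\<^sub>R x + (c * t) *\<^sub>R y) - (c * t) * q y"
        using that c by (intro lowered_le q) auto
      also have "c *\<^sub>R x + (c * t) *\<^sub>R y = c *\<^sub>R (x + t *\<^sub>R y)" by (simp add: algebra_simps)
      also have "q \<dots> = c * q (x + t *\<^sub>R y)" using c by (intro sublinear_scaleR q) auto
      finally show ?thesis using c by (simp add: field_simps)
    qed
    then have "lowered q y (c *\<^sub>R x) / c \<le> lowered q y x" by (intro lowered_greatest)
    then show ?thesis using c by (simp add: field_simps)
  qed
qed

lemma lowered_le_self: "sublinear q \<Longrightarrow> lowered q y x \<le> q x"
  using lowered_le[of q 0] by simp

text \<open>
  By Zorn: along a chain the infimum is finite since \<open>q x \<ge> - q (- x) \<ge> - p (- x)\<close> for all its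
  members, and it is sublinear since any two members of a chain have a common lower bound in it.
\<close>

lemma exists_minimal_sublinear:
  fixes p :: "'a::real_vector \<Rightarrow> real"
  assumes p: "sublinear p"
  shows "\<exists>q. sublinear q \<and> q \<le> p \<and> (\<forall>r. sublinear r \<longrightarrow> r \<le> q \<longrightarrow> r = q)"
proof -
  let ?A = "{q. sublinear q \<and> q \<le> p}"
  have "\<exists>m\<in>?A. \<forall>a\<in>?A. a \<le> m \<longrightarrow> a = m"
  proof (rule predicate_Zorn)
    show "partial_order_on ?A (relation_of (\<lambda>x y. y \<le> x) ?A)"
      by (rule partial_order_on_relation_ofI) auto
  next
    fix C assume C: "C \<in> Chains (relation_of (\<lambda>x y. y \<le> x) ?A)"
    then have CA: "C \<subseteq> ?A" and ch: "\<And>q r. q \<in> C \<Longrightarrow> r \<in> C \<Longrightarrow> q \<le> r \<or> r \<le> q"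
      by (auto simp: Chains_def relation_of_def)
    show "\<exists>u\<in>?A. \<forall>a\<in>C. u \<le> a"
    proof (cases "C = {}")
      case True
      then show ?thesis using p by auto
    next
      case False
      define u where "u x = (INF q\<in>C. q x)" for x
      have "- p (- x) \<le> q x" if "q \<in> C" for q x
      proof -
        have "sublinear q" "q (- x) \<le> p (- x)" using CA that by (auto simp: le_fun_def)
        then show ?thesis using sublinear_minus[of q x] by simp
      qed
      then have bdd: "bdd_below ((\<lambda>q. q x) ` C)" for x by (intro bdd_belowI2) auto
      have le: "u x \<le> q x" if "q \<in> C" for q x
        unfolding u_def by (rule cINF_lower[OF bdd that])
      have great: "a \<le> u x" if "\<And>q. q \<in> C \<Longrightarrow> a \<le> q x" for a x
        unfolding u_def using False that by (rule cINF_greatest)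
      have "sublinear u"
        unfolding sublinear_def
      proof safe
        fix x y
        have *: "u (x + y) \<le> q x + r y" if qr: "q \<in> C" "r \<in> C" for q r
        proof -
          obtain m where m: "m \<in> C" "m \<le> q" "m \<le> r" using ch[OF qr] qr by auto
          then have "u (x + y) \<le> m (x + y)" by (intro le)
          also have "\<dots> \<le> m x + m y" using CA m by (intro sublinear_add) auto
          also have "\<dots> \<le> q x + r y" using m by (auto simp: le_fun_def add_mono)
          finally show ?thesis .
        qed
        have "u (x + y) - q x \<le> u y" if "q \<in> C" for q
          using *[OF that] by (intro great) (simp add: algebra_simps)
        then have "u (x + y) - u y \<le> u x" by (intro great) (simp add: algebra_simps)
        then show "u (x + y) \<le> u x + u y" by simp
      next
        fix t :: real and x assume t: "0 \<le> t"
        have *: "u (t *\<^sub>R x) \<le> t * q x" if "q \<in> C" for q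
          using le[OF that, of "t *\<^sub>R x"] sublinear_scaleR_le[of q t x] CA that t by fastforce
        show "u (t *\<^sub>R x) \<le> t * u x"
        proof (cases "t = 0")
          case True
          then show ?thesis using * False by auto
        next
          case False
          then have "0 < t" using t by simp
          then have "u (t *\<^sub>R x) / t \<le> u x" using * by (intro great) (simp add: field_simps)
          then show ?thesis using \<open>0 < t\<close> by (simp add: field_simps)
        qed
      qed
      moreover have "u \<le> p"
      proof -
        obtain q where "q \<in> C" using False by auto
        then show ?thesis using le[of q] CA by (force simp: le_fun_def intro: order_trans)
      qed
      ultimately show ?thesis using le by (auto simp: le_fun_def)
    qed
  qed
  then obtain m where m: "m \<in> ?A" "\<And>a. a \<in> ?A \<Longrightarrow> a \<le> m \<Longrightarrow> a = m" by blast
  then show ?thesis by (metis (mono_tags, lifting) mem_Collect_eq order_trans)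
qed

text \<open>
  The Hahn-Banach theorem. For a minimal \<open>q\<close>, the functional lowered at \<open>y\<close> is \<open>q\<close> again, and the
  member \<open>t = 1\<close> of the infimum says \<open>q x + q y \<le> q (x + y)\<close>.
\<close>

lemma exists_linear_below_sublinear:
  fixes p :: "'a::real_vector \<Rightarrow> real"
  assumes p: "sublinear p"
  shows "\<exists>f. linear f \<and> (\<forall>x. f x \<le> p x)"
proof -
  obtain q where q: "sublinear q" "q \<le> p" and min: "\<And>r. sublinear r \<Longrightarrow> r \<le> q \<Longrightarrow> r = q"
    using exists_minimal_sublinear[OF p] by blast
  have low: "lowered q y = q" for y
    by (intro min sublinear_lowered q) (simp add: le_fun_def lowered_le_self q)
  have add: "q (x + y) = q x + q y" for x y
    using lowered_le[OF q(1), of 1 y x] sublinear_add[OF q(1), of x y] by (simp add: low)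
  have neg: "q (- x) = - q x" for x
    using add[of x "- x"] by (simp add: sublinear_0[OF q(1)])
  have "q (t *\<^sub>R x) = t * q x" for t x
  proof (cases "0 \<le> t")
    case True
    then show ?thesis by (rule sublinear_scaleR[OF q(1)])
  next
    case False
    then have "q ((- t) *\<^sub>R x) = - t * q x" by (intro sublinear_scaleR[OF q(1)]) simp
    then show ?thesis using neg[of "t *\<^sub>R x"] by simp
  qed
  then have "linear q" using add by (intro linearI) auto
  then show ?thesis using q(2) by (auto simp: le_fun_def)
qed

lemma exists_real_norming_functional:
  fixes x0 :: "'a::real_normed_vector"
  shows "\<exists>f. linear f \<and> (\<forall>x. f x \<le> norm x) \<and> f x0 = norm x0"
proof -
  have n: "sublinear (norm :: 'a \<Rightarrow> real)" by (auto simp: sublinear_def norm_triangle_ineq)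
  obtain f where f: "linear f" "\<And>x. f x \<le> lowered norm x0 x"
    using exists_linear_below_sublinear[OF sublinear_lowered[OF n, of x0]] by blast
  \<comment> \<open>the norm was lowered at \<open>x0\<close> precisely to have this bound\<close>
  have "f (- x0) \<le> - norm x0"
    using f(2)[of "- x0"] lowered_le[OF n, of 1 x0 "- x0"] by simp
  then have "norm x0 \<le> f x0" using f(1) by (simp add: linear_neg)
  moreover have "f x \<le> norm x" for x using f(2)[of x] lowered_le_self[OF n, of x0 x] by simp
  ultimately show ?thesis using f(1) by (metis antisym)
qed

lemma bounded_opsD: "T \<in> bounded_ops \<Longrightarrow> T (c *\<^sub>C x) = c *\<^sub>C T x"
  by (simp add: bounded_ops_def)

lemma functional_scaleC: "\<phi> \<in> bounded_ops \<Longrightarrow> \<phi> (c *\<^sub>C x) = c * \<phi> x"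
  for \<phi> :: "'a::complex_banach \<Rightarrow>\<^sub>L complex"
  by (simp add: bounded_ops_def scaleC_complex_def)

text \<open>
  A real functional \<open>f\<close> is the real part of the complex functional \<open>f x - \<i> f (\<i> x)\<close>, and passing
  to it does not increase the norm: multiply \<open>x\<close> by a unimodular number that makes the value real.
\<close>

theorem exists_norming_functional:
  fixes x0 :: "'a::complex_banach"
  shows "\<exists>\<phi>::'a \<Rightarrow>\<^sub>L complex. \<phi> \<in> bounded_ops \<and> (\<forall>x. cmod (\<phi> x) \<le> norm x) \<and> \<phi> x0 = norm x0"
proof -
  obtain f :: "'a \<Rightarrow> real" where f: "linear f" "\<And>x. f x \<le> norm x" "f x0 = norm x0"
    using exists_real_norming_functional by blast
  have fabs: "\<bar>f x\<bar> \<le> norm x" for x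
    using f(2)[of x] f(2)[of "- x"] f(1) by (auto simp: linear_neg abs_le_iff)
  define g where "g x = Complex (f x) (- f (\<i> *\<^sub>C x))" for x
  have iR: "\<i> *\<^sub>C (r *\<^sub>R x) = r *\<^sub>R (\<i> *\<^sub>C x)" for r and x :: 'a
    using bounded_linear.linear[OF bounded_linear_scaleC[of \<i>]] by (rule linear_scale)
  have lin: "bounded_linear g"
  proof (rule bounded_linear_intro)
    show "g (x + y) = g x + g y" for x y
      by (simp add: g_def complex_eq_iff linear_add[OF f(1)] scaleC_add_right)
    show "g (r *\<^sub>R x) = r *\<^sub>R g x" for r x
      by (simp add: g_def complex_eq_iff linear_scale[OF f(1)] iR)
    show "norm (g x) \<le> norm x * 2" for x
      using cmod_le[of "g x"] fabs[of x] fabs[of "\<i> *\<^sub>C x"] by (simp add: g_def norm_scaleC)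
  qed
  define \<phi> where "\<phi> = Blinfun g"
  have \<phi>: "\<phi> x = g x" for x by (simp add: \<phi>_def bounded_linear_Blinfun_apply lin)
  have gC: "g (c *\<^sub>C x) = c * g x" for c x
  proof -
    have c: "c *\<^sub>C x = Re c *\<^sub>R x + Im c *\<^sub>R (\<i> *\<^sub>C x)" for c and x :: 'a
    proof -
      have "c *\<^sub>C x = (complex_of_real (Re c) + complex_of_real (Im c) * \<i>) *\<^sub>C x"
        by (simp add: complex_eq_iff)
      also have "\<dots> = Re c *\<^sub>R x + Im c *\<^sub>R (\<i> *\<^sub>C x)"
        by (simp only: scaleC_add_left scaleC_of_real flip: scaleC_scaleC)
      finally show ?thesis .
    qed
    have "\<i> *\<^sub>C c *\<^sub>C x = Re c *\<^sub>R (\<i> *\<^sub>C x) - Im c *\<^sub>R x"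
      using c[of "\<i> * c" x] by (simp add: scaleC_scaleC)
    then show ?thesis
      unfolding g_def complex_eq_iff
      by (simp add: c[of c] linear_add[OF f(1)] linear_diff[OF f(1)] linear_scale[OF f(1)])
  qed
  have bo: "\<phi> \<in> bounded_ops" by (simp add: bounded_ops_def \<phi> gC scaleC_complex_def)
  have le: "cmod (\<phi> x) \<le> norm x" for x
  proof -
    \<comment> \<open>rotate \<open>x\<close> so that the value of the functional becomes real\<close>
    define c where "c = cnj (sgn (\<phi> x))"
    have "g (c *\<^sub>C x) = cnj (sgn (g x)) * g x" by (simp add: gC c_def \<phi>)
    also have "\<dots> = complex_of_real (cmod (g x))"
    proof (cases "g x = 0")
      case False
      have "cnj (g x) * g x = complex_of_real ((cmod (g x))\<^sup>2)"
        using complex_norm_square[of "g x"] by (simp add: mult.commute)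
      then show ?thesis using False by (simp add: sgn_div_norm scaleR_conv_of_real power2_eq_square divide_simps)
    qed auto
    finally have "cmod (\<phi> x) = f (c *\<^sub>C x)" by (simp add: \<phi> g_def complex_eq_iff)
    also have "\<dots> \<le> cmod c * norm x" using f(2)[of "c *\<^sub>C x"] by (simp add: norm_scaleC)
    also have "\<dots> \<le> 1 * norm x" by (intro mult_right_mono) (auto simp: c_def norm_sgn)
    finally show ?thesis by simp
  qed
  have "\<phi> x0 = norm x0"
  proof -
    have "Re (\<phi> x0) = norm x0" by (simp add: \<phi> g_def f(3))
    then have "Im (\<phi> x0) = 0"
      using le[of x0] cmod_power2[of "\<phi> x0"] power_mono[OF le[of x0], of 2] by simp
    then show ?thesis using \<open>Re (\<phi> x0) = norm x0\<close> by (simp add: complex_eq_iff)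
  qed
  then show ?thesis using bo le by blast
qed

lemma exists_functional_eq_1:
  fixes x :: "'a::complex_banach"
  assumes "x \<noteq> 0"
  shows "\<exists>\<phi>::'a \<Rightarrow>\<^sub>L complex. \<phi> \<in> bounded_ops \<and> \<phi> x = 1"
proof -
  obtain \<phi> :: "'a \<Rightarrow>\<^sub>L complex" where \<phi>: "\<phi> \<in> bounded_ops" "\<phi> x = norm x"
    using exists_norming_functional by blast
  have "inverse (complex_of_real (norm x)) *\<^sub>C \<phi> \<in> bounded_ops"
    using \<phi>(1) by (simp add: bounded_ops_def scaleC_blinfun_apply scaleC_complex_def)
  moreover have "(inverse (complex_of_real (norm x)) *\<^sub>C \<phi>) x = 1"
    using assms \<phi>(2) by (simp add: scaleC_blinfun_apply scaleC_complex_def)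
  ultimately show ?thesis by blast
qed

lemma bounded_ops_0: "0 \<in> bounded_ops"
  and bounded_ops_add: "S \<in> bounded_ops \<Longrightarrow> T \<in> bounded_ops \<Longrightarrow> S + T \<in> bounded_ops"
  and bounded_ops_diff: "S \<in> bounded_ops \<Longrightarrow> T \<in> bounded_ops \<Longrightarrow> S - T \<in> bounded_ops"
  and bounded_ops_scaleC: "T \<in> bounded_ops \<Longrightarrow> c *\<^sub>C T \<in> bounded_ops"
  and bounded_ops_sum: "(\<And>i. i \<in> I \<Longrightarrow> F i \<in> bounded_ops) \<Longrightarrow> sum F I \<in> bounded_ops"
  by (auto simp: bounded_ops_def blinfun.add_left blinfun.diff_left scaleC_add_right
      complex_vector.scale_right_diff_distrib scaleC_blinfun_apply scaleC_scaleC mult.commute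
      blinfun.sum_left complex_vector.scale_sum_right)

lemma bounded_ops_compose: "S \<in> bounded_ops \<Longrightarrow> T \<in> bounded_ops \<Longrightarrow> S o\<^sub>L T \<in> bounded_ops"
  by (auto simp: bounded_ops_def)

lemma bounded_ops_id: "id_blinfun \<in> bounded_ops"
  by (auto simp: bounded_ops_def)

section \<open>Biorthogonal systems and separable spaces\<close>

definition biorthogonal :: "(nat \<Rightarrow> 'a::complex_banach) \<Rightarrow> (nat \<Rightarrow> 'a \<Rightarrow>\<^sub>L complex) \<Rightarrow> bool" where
  "biorthogonal x \<phi> \<longleftrightarrow>
    (\<forall>n. \<phi> n \<in> bounded_ops) \<and> (\<forall>m n. \<phi> m (x n) = (if m = n then 1 else 0))"

text \<open>
  The next vector is taken in the common kernel of the functionals found so far. This kernel is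
  nonzero: \<open>z - (\<Sum>k<n. \<phi> k z *\<^sub>C x k)\<close> always lies in it, so otherwise the \<open>x k\<close> would span the
  space. A functional equal to 1 at the new vector is then corrected by the earlier ones to vanish
  at the earlier vectors.
\<close>

lemma exists_biorthogonal:
  assumes inf: "infinite_dimensional TYPE('a::complex_banach)"
  shows "\<exists>(x :: nat \<Rightarrow> 'a) \<phi>. biorthogonal x \<phi>"
proof -
  define P where "P f n r \<longleftrightarrow> snd r \<in> bounded_ops \<and> snd r (fst r) = 1 \<and>
      (\<forall>k<n. snd r (fst (f k)) = 0 \<and> snd (f k) (fst r) = 0)"
    for f :: "nat \<Rightarrow> 'a \<times> ('a \<Rightarrow>\<^sub>L complex)" and n :: nat
      and r :: "'a \<times> ('a \<Rightarrow>\<^sub>L complex)"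
  have "\<exists>f :: nat \<Rightarrow> 'a \<times> ('a \<Rightarrow>\<^sub>L complex). \<forall>n. P f n (f n)"
  proof (rule dependent_wellorder_choice)
    show "P f n r = P g n r" if "\<And>k. k < n \<Longrightarrow> f k = g k" for r f g n
      using that by (simp add: P_def)
  next
    fix n f assume IH: "\<And>k. k < n \<Longrightarrow> P f k (f k)"
    define x \<phi> where "x k = fst (f k)" and "\<phi> k = snd (f k)" for k
    have bo: "\<phi> k \<in> bounded_ops" and one: "\<phi> k (x k) = 1" if "k < n" for k
      using IH[OF that] by (auto simp: P_def x_def \<phi>_def)
    have zero: "\<phi> j (x k) = 0" if "j < n" "k < n" "j \<noteq> k" for j k
      using IH[of j] IH[of k] that by (cases j k rule: linorder_cases) (auto simp: P_def x_def \<phi>_def)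
    have "\<exists>z. z \<noteq> 0 \<and> (\<forall>k<n. \<phi> k z = 0)"
    proof (rule ccontr)
      assume no: "\<not> ?thesis"
      have "z \<in> complex_vector.span (x ` {..<n})" for z
      proof -
        have "\<phi> j (z - (\<Sum>k<n. \<phi> k z *\<^sub>C x k)) = 0" if j: "j < n" for j
        proof -
          have "(\<Sum>k<n. \<phi> j (\<phi> k z *\<^sub>C x k)) = (\<Sum>k<n. if k = j then \<phi> j z else 0)"
            using j by (intro sum.cong) (auto simp: functional_scaleC bo one zero)
          then show ?thesis using j by (simp add: blinfun.diff_right blinfun.sum_right)
        qed
        then have "z - (\<Sum>k<n. \<phi> k z *\<^sub>C x k) = 0" using no by blast
        then have "z = (\<Sum>k<n. \<phi> k z *\<^sub>C x k)" by simp
        also have "\<dots> \<in> complex_vector.span (x ` {..<n})"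
          by (intro complex_vector.span_sum complex_vector.span_scale complex_vector.span_base) auto
        finally show ?thesis .
      qed
      then have "complex_vector.span (x ` {..<n}) = UNIV" by auto
      then show False using inf unfolding infinite_dimensional_def by blast
    qed
    then obtain z where z: "z \<noteq> 0" "\<And>k. k < n \<Longrightarrow> \<phi> k z = 0" by blast
    obtain \<zeta> :: "'a \<Rightarrow>\<^sub>L complex" where \<zeta>: "\<zeta> \<in> bounded_ops" "\<zeta> z = 1"
      using exists_functional_eq_1[OF z(1)] by blast
    define \<eta> where "\<eta> = \<zeta> - (\<Sum>k<n. \<zeta> (x k) *\<^sub>C \<phi> k)"
    have eta: "\<eta> v = \<zeta> v - (\<Sum>k<n. \<zeta> (x k) * \<phi> k v)" for v
      by (simp add: \<eta>_def blinfun.diff_left blinfun.sum_left scaleC_blinfun_apply scaleC_complex_def)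
    have "\<eta> (x j) = 0" if j: "j < n" for j
    proof -
      have "(\<Sum>k<n. \<zeta> (x k) * \<phi> k (x j)) = (\<Sum>k<n. if k = j then \<zeta> (x j) else 0)"
        using j by (intro sum.cong) (auto simp: one zero)
      then show ?thesis using j by (simp add: eta)
    qed
    moreover have "\<eta> z = 1" by (simp add: eta z(2) \<zeta>(2))
    moreover have "\<eta> \<in> bounded_ops"
      unfolding \<eta>_def by (intro bounded_ops_diff bounded_ops_sum bounded_ops_scaleC bo \<zeta>) simp
    ultimately have "P f n (z, \<eta>)" using z(2) by (auto simp: P_def x_def \<phi>_def)
    then show "\<exists>r. P f n r" ..
  qed
  then obtain f where f: "\<And>n. P f n (f n)" by blast
  have "snd (f m) (fst (f n)) = (if m = n then 1 else 0)" for m n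
    using f[of m] f[of n] by (cases m n rule: linorder_cases) (auto simp: P_def)
  then have "biorthogonal (\<lambda>n. fst (f n)) (\<lambda>n. snd (f n))"
    using f by (auto simp: biorthogonal_def P_def)
  then show ?thesis by blast
qed

text \<open>
  The countable data through which separability is used: a dense sequence and a functional of norm
  at most one that attains the norm at each of its members.
\<close>

locale norming_sequence =
  fixes q :: "nat \<Rightarrow> 'a::complex_banach" and \<psi> :: "nat \<Rightarrow> 'a \<Rightarrow>\<^sub>L complex"
  assumes dense: "0 < \<epsilon> \<Longrightarrow> \<exists>k. norm (x - q k) < \<epsilon>"
    and \<psi>_bounded_ops: "\<psi> k \<in> bounded_ops"
    and \<psi>_le: "cmod (\<psi> k x) \<le> norm x"
    and \<psi>_norming: "\<psi> k (q k) = norm (q k)"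

lemma exists_norming_sequence:
  assumes "separable_space (euclidean :: 'a::complex_banach topology)"
  shows "\<exists>(q :: nat \<Rightarrow> 'a) \<psi>. norming_sequence q \<psi>"
proof -
  obtain C :: "'a set" where C: "countable C" "closure C = UNIV"
    using assms unfolding separable_space_def by auto
  then have ne: "C \<noteq> {}" by auto
  define q where "q = from_nat_into C"
  have "\<exists>k. norm (x - q k) < \<epsilon>" if \<epsilon>: "0 < \<epsilon>" for x \<epsilon>
  proof -
    have "x \<in> closure C" using C by simp
    then obtain y where "y \<in> C" "dist y x < \<epsilon>"
      using \<epsilon> unfolding closure_approachable by blast
    moreover from this(1) obtain k where "q k = y"
      using from_nat_into_surj[OF C(1)] by (auto simp: q_def)
    ultimately show ?thesis by (auto simp: dist_norm norm_minus_commute)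
  qed
  moreover have "\<forall>k. \<exists>\<phi>::'a \<Rightarrow>\<^sub>L complex.
      \<phi> \<in> bounded_ops \<and> (\<forall>x. cmod (\<phi> x) \<le> norm x) \<and> \<phi> (q k) = norm (q k)"
    using exists_norming_functional by blast
  from choice[OF this] obtain \<psi> :: "nat \<Rightarrow> 'a \<Rightarrow>\<^sub>L complex" where
    "\<And>k. \<psi> k \<in> bounded_ops \<and> (\<forall>x. cmod (\<psi> k x) \<le> norm x) \<and> \<psi> k (q k) = norm (q k)"
    by blast
  ultimately have "norming_sequence q \<psi>" by unfold_locales auto
  then show ?thesis by blast
qed

context norming_sequence
begin

lemma norm_le_of_norming:
  assumes "\<And>k. cmod (\<psi> k x) \<le> r"
  shows "norm x \<le> r"
proof (rule field_le_epsilon)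
  fix \<epsilon> :: real assume "0 < \<epsilon>"
  then obtain k where k: "norm (x - q k) < \<epsilon> / 2" using dense[of "\<epsilon> / 2" x] by auto
  have "norm (q k) = cmod (\<psi> k x - \<psi> k (x - q k))" by (simp add: blinfun.diff_right \<psi>_norming)
  also have "\<dots> \<le> cmod (\<psi> k x) + cmod (\<psi> k (x - q k))" by (rule norm_triangle_ineq4)
  also have "\<dots> \<le> r + norm (x - q k)" using assms \<psi>_le by (intro add_mono)
  finally show "norm x \<le> r + \<epsilon>" using k norm_triangle_sub[of x "q k"] by simp
qed

lemma eq_of_norming: "(\<And>k. \<psi> k x = \<psi> k y) \<Longrightarrow> x = y"
  using norm_le_of_norming[of "x - y" 0] by (simp add: blinfun.diff_right)

lemma closed_of_dense:
  assumes "closed S" "\<And>k. q k \<in> S"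
  shows "x \<in> S"
proof -
  have "x \<in> closure S"
    unfolding closure_approachable using dense[of _ x] assms(2)
    by (metis dist_norm norm_minus_commute)
  then show ?thesis using assms(1) by simp
qed

lemma blinfun_eq_of_dense:
  fixes S T :: "'a \<Rightarrow>\<^sub>L 'b::real_normed_vector"
  assumes "\<And>k. S (q k) = T (q k)"
  shows "S = T"
proof (rule blinfun_eqI)
  fix x
  have "closed {x. S x = T x}"
    by (intro closed_Collect_eq continuous_intros)
  then show "S x = T x" using closed_of_dense[of "{x. S x = T x}" x] assms by simp
qed

lemma blinfun_norm_le_of_dense:
  fixes T :: "'a \<Rightarrow>\<^sub>L 'b::real_normed_vector"
  assumes "\<And>k. norm (T (q k)) \<le> r * norm (q k)" and "0 \<le> r"
  shows "norm T \<le> r"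
proof (rule norm_blinfun_bound[OF \<open>0 \<le> r\<close>])
  fix x
  have "closed {x. norm (T x) \<le> r * norm x}"
    by (intro closed_Collect_le continuous_intros)
  then show "norm (T x) \<le> r * norm x"
    using closed_of_dense[of "{x. norm (T x) \<le> r * norm x}" x] assms by simp
qed

end

section \<open>Weak operator measurability\<close>

lemma (in complete_measure) borel_measurable_cong_AE:
  assumes f: "f \<in> borel_measurable M" and eq: "AE s in M. f s = g s"
  shows "g \<in> borel_measurable M"
proof (rule measurableI)
  fix S :: "'b set" assume S: "S \<in> sets borel"
  show "g -` S \<inter> space M \<in> sets M"
  proof (rule in_sets_AE)
    show "AE s in M. (s \<in> f -` S \<inter> space M) = (s \<in> g -` S \<inter> space M)"
      using eq by eventually_elim auto
    show "f -` S \<inter> space M \<in> sets M" using f S by (rule measurable_sets)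
  qed auto
qed auto

definition weakly_measurable :: "'s measure \<Rightarrow> ('s \<Rightarrow> 'a::complex_banach) \<Rightarrow> bool" where
  "weakly_measurable M y \<longleftrightarrow>
    (\<forall>\<phi>\<in>(bounded_ops :: ('a \<Rightarrow>\<^sub>L complex) set). (\<lambda>s. \<phi> (y s)) \<in> borel_measurable M)"

lemma weakly_measurableI:
  "(\<And>\<phi> :: 'a::complex_banach \<Rightarrow>\<^sub>L complex. \<phi> \<in> bounded_ops \<Longrightarrow> (\<lambda>s. \<phi> (y s)) \<in> borel_measurable M)
    \<Longrightarrow> weakly_measurable M y"
  by (auto simp: weakly_measurable_def)

lemma weakly_measurableD:
  "weakly_measurable M y \<Longrightarrow> \<phi> \<in> bounded_ops \<Longrightarrow> (\<lambda>s. \<phi> (y s)) \<in> borel_measurable M"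
  for \<phi> :: "'a::complex_banach \<Rightarrow>\<^sub>L complex"
  by (auto simp: weakly_measurable_def)

lemma weakly_measurable_const: "weakly_measurable M (\<lambda>_. x)"
  by (rule weakly_measurableI) simp

lemma weakly_measurable_add:
  "weakly_measurable M y \<Longrightarrow> weakly_measurable M z \<Longrightarrow> weakly_measurable M (\<lambda>s. y s + z s)"
  by (auto simp: weakly_measurable_def blinfun.add_right intro!: borel_measurable_add)

lemma weakly_measurable_diff:
  "weakly_measurable M y \<Longrightarrow> weakly_measurable M z \<Longrightarrow> weakly_measurable M (\<lambda>s. y s - z s)"
  by (auto simp: weakly_measurable_def blinfun.diff_right intro!: borel_measurable_diff)

lemma weakly_measurable_scaleC:
  "a \<in> borel_measurable M \<Longrightarrow> weakly_measurable M y \<Longrightarrow> weakly_measurable M (\<lambda>s. a s *\<^sub>C y s)"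
  by (auto simp: weakly_measurable_def functional_scaleC)

lemma weakly_measurable_limit:
  fixes z :: "'s \<Rightarrow> 'a::complex_banach"
  assumes "\<And>n. weakly_measurable M (y n)" "\<And>s. s \<in> space M \<Longrightarrow> (\<lambda>n. y n s) \<longlonglongrightarrow> z s"
  shows "weakly_measurable M z"
proof (rule weakly_measurableI)
  fix \<phi> :: "'a \<Rightarrow>\<^sub>L complex" assume \<phi>: "\<phi> \<in> bounded_ops"
  show "(\<lambda>s. \<phi> (z s)) \<in> borel_measurable M"
  proof (rule borel_measurable_LIMSEQ_metric)
    show "(\<lambda>s. \<phi> (y n s)) \<in> borel_measurable M" for n
      using assms(1) \<phi> by (rule weakly_measurableD)
    show "(\<lambda>n. \<phi> (y n s)) \<longlonglongrightarrow> \<phi> (z s)" if "s \<in> space M" for s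
      by (intro tendsto_intros assms(2) that)
  qed
qed

lemma weakly_measurable_countable:
  assumes "\<And>k. weakly_measurable M (y k)" "\<kappa> \<in> M \<rightarrow>\<^sub>M count_space (UNIV :: nat set)"
  shows "weakly_measurable M (\<lambda>s. y (\<kappa> s) s)"
  by (rule weakly_measurableI, rule measurable_compose_countable[OF _ assms(2)])
     (rule weakly_measurableD[OF assms(1)])

lemma weakly_measurable_cong_AE:
  assumes "complete_measure M" "weakly_measurable M y" "AE s in M. y s = z s"
  shows "weakly_measurable M z"
proof (rule weakly_measurableI)
  fix \<phi> :: "'b \<Rightarrow>\<^sub>L complex" assume \<phi>: "\<phi> \<in> bounded_ops"
  show "(\<lambda>s. \<phi> (z s)) \<in> borel_measurable M"
  proof (rule complete_measure.borel_measurable_cong_AE[OF assms(1)])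
    show "(\<lambda>s. \<phi> (y s)) \<in> borel_measurable M" using assms(2) \<phi> by (rule weakly_measurableD)
    show "AE s in M. \<phi> (y s) = \<phi> (z s)" using assms(3) by eventually_elim simp
  qed
qed

lemma wo_measurableI:
  assumes "\<And>s. s \<in> space M \<Longrightarrow> f s \<in> bounded_ops" "\<And>x. weakly_measurable M (\<lambda>s. f s x)"
  shows "f \<in> wo_measurable M"
  using assms by (auto simp: wo_measurable_def weakly_measurable_def)

lemma wo_measurable_bounded_ops: "f \<in> wo_measurable M \<Longrightarrow> s \<in> space M \<Longrightarrow> f s \<in> bounded_ops"
  by (auto simp: wo_measurable_def)

lemma wo_measurable_apply_const: "f \<in> wo_measurable M \<Longrightarrow> weakly_measurable M (\<lambda>s. f s x)"
  by (auto simp: wo_measurable_def weakly_measurable_def)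

lemma wo_measurable_const: "T \<in> bounded_ops \<Longrightarrow> (\<lambda>_. T) \<in> wo_measurable M"
  by (intro wo_measurableI weakly_measurable_const)

lemma wo_measurable_add:
  "f \<in> wo_measurable M \<Longrightarrow> g \<in> wo_measurable M \<Longrightarrow> (\<lambda>s. f s + g s) \<in> wo_measurable M"
  by (intro wo_measurableI bounded_ops_add)
     (auto simp: blinfun.add_left intro: weakly_measurable_add wo_measurable_apply_const wo_measurable_bounded_ops)

lemma wo_measurable_diff:
  "f \<in> wo_measurable M \<Longrightarrow> g \<in> wo_measurable M \<Longrightarrow> (\<lambda>s. f s - g s) \<in> wo_measurable M"
  by (intro wo_measurableI bounded_ops_diff)
     (auto simp: blinfun.diff_left intro: weakly_measurable_diff wo_measurable_apply_const wo_measurable_bounded_ops)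

lemma wo_measurable_scaleC:
  "a \<in> borel_measurable M \<Longrightarrow> f \<in> wo_measurable M \<Longrightarrow> (\<lambda>s. a s *\<^sub>C f s) \<in> wo_measurable M"
  by (intro wo_measurableI bounded_ops_scaleC)
     (auto simp: scaleC_blinfun_apply intro: weakly_measurable_scaleC wo_measurable_apply_const wo_measurable_bounded_ops)

context norming_sequence
begin

lemma norm_measurable:
  fixes y :: "'s \<Rightarrow> 'a"
  assumes "weakly_measurable M y"
  shows "(\<lambda>s. norm (y s)) \<in> borel_measurable M"
proof (rule borel_measurableI_le)
  fix r
  have [measurable]: "(\<lambda>s. \<psi> k (y s)) \<in> borel_measurable M" for k
    by (rule weakly_measurableD[OF assms \<psi>_bounded_ops])
  have "{s \<in> space M. norm (y s) \<le> r} = {s \<in> space M. \<forall>k. cmod (\<psi> k (y s)) \<le> r}"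
    using \<psi>_le norm_le_of_norming by (auto intro: order_trans)
  also have "\<dots> \<in> sets M" by measurable
  finally show "{s \<in> space M. norm (y s) \<le> r} \<in> sets M" .
qed

text \<open>
  The step of the Pettis measurability theorem that matters here: the norm is a countable supremum
  of measurable functions by \<open>norm_measurable\<close>, hence the first member of the dense sequence
  within distance \<open>\<epsilon>\<close> is chosen measurably.
\<close>

lemma exists_countable_approximation:
  fixes y :: "'s \<Rightarrow> 'a"
  assumes y: "weakly_measurable M y" and \<epsilon>: "0 < \<epsilon>"
  shows "\<exists>\<kappa>\<in>M \<rightarrow>\<^sub>M count_space UNIV. \<forall>s. norm (y s - q (\<kappa> s)) < \<epsilon>"
proof (intro bexI allI)
  define \<kappa> where "\<kappa> s = (LEAST k. norm (y s - q k) < \<epsilon>)" for s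
  show "norm (y s - q (\<kappa> s)) < \<epsilon>" for s
    unfolding \<kappa>_def using dense[OF \<epsilon>, of "y s"] by (rule LeastI_ex)
  have [measurable]: "(\<lambda>s. norm (y s - q k)) \<in> borel_measurable M" for k
    by (intro norm_measurable weakly_measurable_diff y weakly_measurable_const)
  show "\<kappa> \<in> M \<rightarrow>\<^sub>M count_space UNIV"
    unfolding \<kappa>_def by measurable
qed

text \<open>
  The values of \<open>f\<close> are continuous operators and \<open>y\<close> is a limit of countably valued fields, for
  which the claim holds piece by piece.
\<close>

lemma wo_measurable_apply:
  fixes y :: "'s \<Rightarrow> 'a"
  assumes f: "f \<in> wo_measurable M" and y: "weakly_measurable M y"
  shows "weakly_measurable M (\<lambda>s. f s (y s))"
proof -
  have "\<forall>n. \<exists>\<kappa>\<in>M \<rightarrow>\<^sub>M count_space UNIV. \<forall>s. norm (y s - q (\<kappa> s)) < inverse (real (Suc n))"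
    by (intro allI exists_countable_approximation y) simp
  then obtain \<kappa> where \<kappa>: "\<And>n. \<kappa> n \<in> M \<rightarrow>\<^sub>M count_space UNIV"
      "\<And>n s. norm (y s - q (\<kappa> n s)) < inverse (real (Suc n))"
    by metis
  show ?thesis
  proof (rule weakly_measurable_limit)
    show "weakly_measurable M (\<lambda>s. f s (q (\<kappa> n s)))" for n
      by (rule weakly_measurable_countable[OF wo_measurable_apply_const[OF f] \<kappa>(1)])
    have "(\<lambda>n. q (\<kappa> n s)) \<longlonglongrightarrow> y s" for s
    proof (rule metric_LIMSEQ_I)
      fix r :: real assume "0 < r"
      then obtain N where N: "inverse (real (Suc N)) < r" using reals_Archimedean by blast
      have "dist (q (\<kappa> n s)) (y s) < r" if "N \<le> n" for n
      proof -
        have "dist (q (\<kappa> n s)) (y s) < inverse (real (Suc n))"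
          using \<kappa>(2)[of s n] by (simp add: dist_norm norm_minus_commute)
        also have "\<dots> \<le> inverse (real (Suc N))" using that by (intro le_imp_inverse_le) auto
        finally show ?thesis using N by simp
      qed
      then show "\<exists>N. \<forall>n\<ge>N. dist (q (\<kappa> n s)) (y s) < r" by blast
    qed
    then show "(\<lambda>n. f s (q (\<kappa> n s))) \<longlonglongrightarrow> f s (y s)" for s
      by (intro tendsto_intros)
  qed
qed

lemma wo_measurable_compose:
  fixes f g :: "'s \<Rightarrow> 'a \<Rightarrow>\<^sub>L 'a"
  assumes f: "f \<in> wo_measurable M" and g: "g \<in> wo_measurable M"
  shows "(\<lambda>s. f s o\<^sub>L g s) \<in> wo_measurable M"
proof (rule wo_measurableI)
  show "f s o\<^sub>L g s \<in> bounded_ops" if "s \<in> space M" for s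
    using assms that by (intro bounded_ops_compose wo_measurable_bounded_ops)
  show "weakly_measurable M (\<lambda>s. (f s o\<^sub>L g s) x)" for x
    using wo_measurable_apply[OF f wo_measurable_apply_const[OF g, of x]] by simp
qed

lemma norm_wo_measurable:
  fixes f :: "'s \<Rightarrow> 'a \<Rightarrow>\<^sub>L 'a"
  assumes f: "f \<in> wo_measurable M"
  shows "(\<lambda>s. norm (f s)) \<in> borel_measurable M"
proof (rule borel_measurableI_le)
  fix r
  have [measurable]: "(\<lambda>s. norm (f s (q k))) \<in> borel_measurable M" for k
    by (intro norm_measurable wo_measurable_apply_const f)
  show "{s \<in> space M. norm (f s) \<le> r} \<in> sets M"
  proof (cases "0 \<le> r")
    case True
    have "{s \<in> space M. norm (f s) \<le> r} = {s \<in> space M. \<forall>k. norm (f s (q k)) \<le> r * norm (q k)}"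
    proof -
      have "norm (f s (q k)) \<le> r * norm (q k)" if "norm (f s) \<le> r" for s k
        using norm_blinfun[of "f s" "q k"] mult_right_mono[OF that norm_ge_zero[of "q k"]] by simp
      then show ?thesis using blinfun_norm_le_of_dense[OF _ True] by blast
    qed
    also have "\<dots> \<in> sets M" by measurable
    finally show ?thesis .
  next
    case False
    then have empty: "{s \<in> space M. norm (f s) \<le> r} = {}"
      using norm_ge_zero order_trans by blast
    show ?thesis unfolding empty by simp
  qed
qed

text \<open>
  A uniform boundedness principle with parameters: a single field \<open>y\<close> detects, for all \<open>s\<close> at
  once, whether the functionals \<open>l j s\<close> are bounded in norm. At a bad \<open>s\<close>, nested balls are chosen
  so that on the \<open>n\<close>-th one some \<open>l j s\<close> is at least \<open>n\<close> in modulus, and \<open>y s\<close> is their common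
  point. Taking centres from the dense sequence and radii \<open>2\<^bsup>-m\<^esup>\<close> makes the candidates countable,
  so that always choosing the first suitable one yields a measurable field.
\<close>

lemma measurable_gliding_hump:
  fixes l :: "nat \<Rightarrow> 's \<Rightarrow> 'a \<Rightarrow>\<^sub>L complex"
  assumes l[measurable]: "\<And>j x. (\<lambda>s. l j s x) \<in> borel_measurable M"
  shows "\<exists>y. weakly_measurable M y \<and> (\<forall>s. norm (y s) \<le> 1) \<and>
    (\<forall>s C. (\<forall>j. cmod (l j s (y s)) \<le> C) \<longrightarrow> (\<exists>C'. \<forall>j. norm (l j s) \<le> C'))"
proof -
  define bad where "bad s \<longleftrightarrow> (\<forall>N::nat. \<exists>j i. real N * norm (q i) < cmod (l j s (q i)))" for s
  have bad_iff: "bad s \<longleftrightarrow> \<not> (\<exists>C. \<forall>j. norm (l j s) \<le> C)" for s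
  proof
    assume b: "bad s"
    show "\<not> (\<exists>C. \<forall>j. norm (l j s) \<le> C)"
    proof
      assume "\<exists>C. \<forall>j. norm (l j s) \<le> C"
      then obtain C where C: "\<And>j. norm (l j s) \<le> C" by blast
      obtain N :: nat where N: "C \<le> N" using real_arch_simple by blast
      obtain j i where "real N * norm (q i) < cmod (l j s (q i))"
        using b unfolding bad_def by blast
      moreover have "cmod (l j s (q i)) \<le> norm (l j s) * norm (q i)" by (rule norm_blinfun)
      moreover have "\<dots> \<le> N * norm (q i)" using C[of j] N by (intro mult_right_mono) auto
      ultimately show False by simp
    qed
  next
    assume "\<not> (\<exists>C. \<forall>j. norm (l j s) \<le> C)"
    then have "\<exists>j i. real N * norm (q i) < cmod (l j s (q i))" for N :: nat
      using blinfun_norm_le_of_dense[of "l _ s" "real N"] by (meson not_le of_nat_0_le_iff)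
    then show "bad s" by (simp add: bad_def)
  qed
  have [measurable]: "Measurable.pred M bad"
    unfolding bad_def by measurable
  \<comment> \<open>a natural number \<open>k\<close> encodes the ball with centre \<open>c k\<close> and radius \<open>r k\<close>\<close>
  define c r where "c k = q (fst (prod_decode k))" and "r k = inverse (2 ^ snd (prod_decode k) :: real)" for k
  define K where "K k = cball (c k) (r k)" for k
  \<comment> \<open>the lower bound is demanded only at members of the dense sequence, which keeps the condition measurable
  in \<open>s\<close>; it carries over to \<open>y s\<close> because the centres converging to \<open>y s\<close> are such members\<close>
  define R where "R n s k k' \<longleftrightarrow> r k' \<le> inverse (2 ^ n) \<and> K k' \<subseteq> K k \<and>
      (\<exists>j. \<forall>i. q i \<in> K k' \<longrightarrow> real n \<le> cmod (l j s (q i)))" for n s k k'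
  have small_power: "\<exists>m. inverse (2 ^ m) < \<epsilon>" if "0 < \<epsilon>" for \<epsilon> :: real
    using real_arch_pow_inv[OF that, of "inverse 2"] by (simp add: power_one_over inverse_eq_divide)
  have step: "\<exists>k'. R n s k k'" if b: "bad s" for n s k
  proof -
    have rk: "0 < r k" by (simp add: r_def)
    have "\<exists>j x. x \<in> ball (c k) (r k) \<and> real n < cmod (l j s x)"
    proof (rule ccontr)
      assume "\<not> ?thesis"
      then have small: "cmod (l j s x) \<le> real n" if "x \<in> ball (c k) (r k)" for j x
        using that by (meson not_le)
      \<comment> \<open>the difference of two points of the ball may be any vector of norm \<open>r k / 2\<close>\<close>
      have "norm (l j s) \<le> 4 * real n / r k" for j
      proof (rule norm_blinfun_bound)
        show "0 \<le> 4 * real n / r k" using rk by simp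
        fix v
        show "cmod (l j s v) \<le> 4 * real n / r k * norm v"
        proof (cases "v = 0")
          case False
          define t where "t = r k / (2 * norm v)"
          have t: "0 < t" using False rk by (simp add: t_def)
          have "dist (c k) (c k + t *\<^sub>R v) = r k / 2"
            using False rk by (simp add: dist_norm t_def)
          then have "c k + t *\<^sub>R v \<in> ball (c k) (r k)" using rk by simp
          then have "cmod (l j s (c k + t *\<^sub>R v)) \<le> real n" by (rule small)
          moreover have "cmod (l j s (c k)) \<le> real n" using rk by (intro small) simp
          moreover have "l j s (t *\<^sub>R v) = l j s (c k + t *\<^sub>R v) - l j s (c k)"
            by (simp add: blinfun.add_right)
          ultimately have "cmod (l j s (t *\<^sub>R v)) \<le> real n + real n"
            using norm_triangle_ineq4[of "l j s (c k + t *\<^sub>R v)" "l j s (c k)"] by simp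
          then have "t * cmod (l j s v) \<le> real n + real n" using t by (simp add: blinfun.scaleR_right)
          then show ?thesis using False rk by (simp add: t_def field_simps)
        qed simp
      qed
      then show False using b by (auto simp: bad_iff)
    qed
    then obtain j x where x: "x \<in> ball (c k) (r k)" "real n < cmod (l j s x)" by blast
    have "open (ball (c k) (r k) \<inter> {z. real n < cmod (l j s z)})"
      by (intro open_Int open_ball open_Collect_less continuous_intros)
    then obtain \<delta> where \<delta>: "0 < \<delta>" "ball x \<delta> \<subseteq> ball (c k) (r k) \<inter> {z. real n < cmod (l j s z)}"
      using x unfolding open_contains_ball by blast
    obtain m0 where m0: "inverse (2 ^ m0) < \<delta> / 2"
      using small_power[of "\<delta> / 2"] \<delta>(1) by auto
    define m where "m = max m0 n"
    have m: "inverse (2 ^ m) < \<delta> / 2" "inverse (2 ^ m :: real) \<le> inverse (2 ^ n)"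
    proof -
      have "inverse (2 ^ m :: real) \<le> inverse (2 ^ m0)" by (intro le_imp_inverse_le) (auto simp: m_def)
      then show "inverse (2 ^ m) < \<delta> / 2" using m0 by linarith
      show "inverse (2 ^ m :: real) \<le> inverse (2 ^ n)" by (intro le_imp_inverse_le) (auto simp: m_def)
    qed
    obtain i where i: "norm (x - q i) < inverse (2 ^ m)" using dense[of "inverse (2 ^ m)" x] by auto
    have sub: "cball (q i) (inverse (2 ^ m)) \<subseteq> ball x \<delta>"
    proof
      fix z assume "z \<in> cball (q i) (inverse (2 ^ m))"
      then have "dist (q i) z \<le> inverse (2 ^ m)" by simp
      then show "z \<in> ball x \<delta>"
        using i m(1) dist_triangle[of x z "q i"] by (simp add: dist_norm)
    qed
    define k' where "k' = prod_encode (i, m)"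
    have K': "K k' = cball (q i) (inverse (2 ^ m))" by (simp add: K_def c_def r_def k'_def)
    have "K k' \<subseteq> K k"
      using sub \<delta>(2) ball_subset_cball[of "c k" "r k"] unfolding K' unfolding K_def by blast
    moreover have "\<forall>i. q i \<in> K k' \<longrightarrow> real n \<le> cmod (l j s (q i))"
      using sub \<delta>(2) unfolding K' by (blast intro: less_imp_le)
    moreover have "r k' \<le> inverse (2 ^ n)" using m(2) by (simp add: r_def k'_def)
    ultimately have "R n s k k'" unfolding R_def by blast
    then show ?thesis ..
  qed
  obtain i0 where i0: "norm (0 - q i0) < 1 / 2" using dense[of "1 / 2" 0] by auto
  define k0 where "k0 = prod_encode (i0, 1)"
  define \<kappa> where "\<kappa> = rec_nat (\<lambda>s. k0) (\<lambda>n \<kappa>n s. LEAST k'. R n s (\<kappa>n s) k')"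
  have \<kappa>_0: "\<kappa> 0 s = k0" and \<kappa>_Suc: "\<kappa> (Suc n) s = (LEAST k'. R n s (\<kappa> n s) k')" for n s
    by (simp_all add: \<kappa>_def)
  have R_meas: "Measurable.pred M (\<lambda>s. R n s k k')" for n k k'
    unfolding R_def by measurable
  have \<kappa>_meas[measurable]: "\<kappa> n \<in> M \<rightarrow>\<^sub>M count_space UNIV" for n
  proof (induction n)
    case 0
    have "\<kappa> 0 = (\<lambda>s. k0)" by (auto simp: \<kappa>_0)
    then show ?case by simp
  next
    case (Suc n)
    have "Measurable.pred M (\<lambda>s. R n s (\<kappa> n s) k')" for k'
      by (rule measurable_compose_countable[OF R_meas Suc])
    then have "(\<lambda>s. LEAST k'. R n s (\<kappa> n s) k') \<in> M \<rightarrow>\<^sub>M count_space UNIV" by measurable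
    then show ?case by (simp add: \<kappa>_Suc[abs_def])
  qed
  have R_\<kappa>: "R n s (\<kappa> n s) (\<kappa> (Suc n) s)" if "bad s" for n s
    unfolding \<kappa>_Suc using step[OF that] by (rule LeastI_ex)
  have nested: "K (\<kappa> m s) \<subseteq> K (\<kappa> n s)" if "bad s" "n \<le> m" for n m s
    by (rule lift_Suc_antimono_le[of "\<lambda>n. K (\<kappa> n s)"])
       (use R_\<kappa>[OF that(1)] that(2) in \<open>auto simp: R_def\<close>)
  have c_in: "c (\<kappa> m s) \<in> K (\<kappa> n s)" if "bad s" "n \<le> m" for n m s
  proof -
    have "c (\<kappa> m s) \<in> K (\<kappa> m s)" by (simp add: K_def r_def)
    then show ?thesis using nested[OF that] by blast
  qed
  have conv: "convergent (\<lambda>n. c (\<kappa> n s))" if b: "bad s" for s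
  proof -
    have "Cauchy (\<lambda>n. c (\<kappa> n s))"
    proof (rule metric_CauchyI)
      fix \<epsilon> :: real assume "0 < \<epsilon>"
      then obtain N where N: "inverse (2 ^ N) < \<epsilon> / 2"
        using small_power[of "\<epsilon> / 2"] by auto
      have *: "dist (c (\<kappa> (Suc N) s)) (c (\<kappa> m s)) < \<epsilon> / 2" if "Suc N \<le> m" for m
        using c_in[OF b that] R_\<kappa>[OF b, of N] N by (auto simp: K_def R_def)
      have "dist (c (\<kappa> m s)) (c (\<kappa> n s)) < \<epsilon>" if "Suc N \<le> m" "Suc N \<le> n" for m n
        using dist_triangle_half_r[OF *[OF that(1)] *[OF that(2)]] .
      then show "\<exists>N. \<forall>m\<ge>N. \<forall>n\<ge>N. dist (c (\<kappa> m s)) (c (\<kappa> n s)) < \<epsilon>" by blast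
    qed
    then show ?thesis by (simp add: Cauchy_convergent_iff)
  qed
  define y where "y s = (if bad s then lim (\<lambda>n. c (\<kappa> n s)) else 0)" for s
  have tends: "(\<lambda>n. c (\<kappa> n s)) \<longlonglongrightarrow> y s" if "bad s" for s
    using conv[OF that] that by (simp add: y_def convergent_LIMSEQ_iff)
  have y_norm: "norm (y s) \<le> 1" for s
  proof (cases "bad s")
    case True
    have "y s \<in> K (\<kappa> 0 s)"
      using c_in[OF True, of 0] by (intro Lim_in_closed_set[OF _ _ _ tends[OF True]]) (auto simp: K_def)
    then have "norm (y s - q i0) \<le> 1 / 2"
      by (simp add: K_def \<kappa>_0 k0_def c_def r_def dist_norm norm_minus_commute)
    then show ?thesis using i0 norm_triangle_sub[of "y s" "q i0"] by simp
  qed (simp add: y_def)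
  have y_meas: "weakly_measurable M y"
  proof (rule weakly_measurable_limit)
    show "weakly_measurable M (\<lambda>s. if bad s then c (\<kappa> n s) else 0)" for n
    proof (rule weakly_measurableI)
      fix \<phi> :: "'a \<Rightarrow>\<^sub>L complex"
      have "(\<lambda>s. \<phi> (c (\<kappa> n s))) \<in> borel_measurable M"
        by (rule measurable_compose_countable[OF _ \<kappa>_meas]) simp
      then have "(\<lambda>s. if bad s then \<phi> (c (\<kappa> n s)) else 0) \<in> borel_measurable M" by measurable
      moreover have "\<phi> (if bad s then c (\<kappa> n s) else 0) = (if bad s then \<phi> (c (\<kappa> n s)) else 0)" for s
        by simp
      ultimately show "(\<lambda>s. \<phi> (if bad s then c (\<kappa> n s) else 0)) \<in> borel_measurable M"
        by (simp only:)
    qed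
    show "(\<lambda>n. if bad s then c (\<kappa> n s) else 0) \<longlonglongrightarrow> y s" for s
      using tends[of s] by (cases "bad s") (auto simp: y_def)
  qed
  have unbounded: False if b: "bad s" and C: "\<And>j. cmod (l j s (y s)) \<le> C" for s C
  proof -
    obtain n :: nat where n: "C < real n" using reals_Archimedean2 by blast
    obtain j where j: "\<And>i. q i \<in> K (\<kappa> (Suc n) s) \<Longrightarrow> real n \<le> cmod (l j s (q i))"
      using R_\<kappa>[OF b, of n] by (auto simp: R_def)
    have "(\<lambda>m. cmod (l j s (c (\<kappa> m s)))) \<longlonglongrightarrow> cmod (l j s (y s))"
      by (intro tendsto_intros tends[OF b])
    moreover have "\<forall>\<^sub>F m in sequentially. real n \<le> cmod (l j s (c (\<kappa> m s)))"
      using c_in[OF b, of "Suc n"] j unfolding c_def eventually_sequentially by blast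
    ultimately have "real n \<le> cmod (l j s (y s))"
      by (intro tendsto_lowerbound[of _ _ sequentially]) auto
    then show False using C[of j] n by simp
  qed
  show ?thesis
    using y_meas y_norm unbounded bad_iff by blast
qed

end

section \<open>Algebra of equivalence classes\<close>

lemma mem_wo_class_iff:
  "h \<in> wo_class M f \<longleftrightarrow> f \<in> wo_measurable M \<and> h \<in> wo_measurable M \<and> (AE s in M. f s = h s)"
  by (auto simp: wo_class_def ae_rel_def)

lemma mem_L0_class_iff:
  "h \<in> L0_class M g \<longleftrightarrow> g \<in> borel_measurable M \<and> h \<in> borel_measurable M \<and> (AE s in M. g s = h s)"
  by (auto simp: L0_class_def ae_rel_def)

lemma wo_class_eq_iff:
  "f \<in> wo_measurable M \<Longrightarrow> g \<in> wo_measurable M \<Longrightarrow> wo_class M f = wo_class M g \<longleftrightarrow> (AE s in M. f s = g s)"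
  unfolding wo_class_def
  by (subst eq_equiv_class_iff[OF equiv_ae_rel]) (auto simp: ae_rel_def)

lemma wo_class_in_L0_wo: "f \<in> wo_measurable M \<Longrightarrow> wo_class M f \<in> L0_wo M bounded_ops"
  by (auto simp: L0_wo_def wo_measurable_def)

lemma L0_wo_bounded_opsE:
  assumes "F \<in> L0_wo M bounded_ops"
  obtains f where "f \<in> wo_measurable M" "F = wo_class M f"
  using assms by (auto simp: L0_wo_def)

text \<open>
  The union in \<open>wo_lift2\<close> collapses: any choice of representatives gives the same class.
\<close>

lemma wo_lift2_eq:
  assumes fg: "f \<in> F" "g \<in> G"
    and meas: "\<And>f' g'. f' \<in> F \<Longrightarrow> g' \<in> G \<Longrightarrow> (\<lambda>s. op (f' s) (g' s)) \<in> wo_measurable M"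
    and F: "\<And>f'. f' \<in> F \<Longrightarrow> AE s in M. f s = f' s"
    and G: "\<And>g'. g' \<in> G \<Longrightarrow> AE s in M. g s = g' s"
  shows "wo_lift2 M op F G = wo_class M (\<lambda>s. op (f s) (g s))"
proof -
  have "wo_class M (\<lambda>s. op (f' s) (g' s)) = wo_class M (\<lambda>s. op (f s) (g s))" if "f' \<in> F" "g' \<in> G" for f' g'
  proof (subst wo_class_eq_iff)
    show "AE s in M. op (f' s) (g' s) = op (f s) (g s)"
      using F[OF that(1)] G[OF that(2)] by eventually_elim simp
  qed (use meas that fg in auto)
  then show ?thesis using fg unfolding wo_lift2_def by blast
qed

lemma wo_add_class:
  assumes "f \<in> wo_measurable M" "g \<in> wo_measurable M"
  shows "wo_add M (wo_class M f) (wo_class M g) = wo_class M (\<lambda>s. f s + g s)"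
  unfolding wo_add_def using assms
  by (intro wo_lift2_eq) (auto simp: mem_wo_class_iff intro: wo_measurable_add)

lemma wo_diff_class:
  assumes "f \<in> wo_measurable M" "g \<in> wo_measurable M"
  shows "wo_diff M (wo_class M f) (wo_class M g) = wo_class M (\<lambda>s. f s - g s)"
  unfolding wo_diff_def using assms
  by (intro wo_lift2_eq) (auto simp: mem_wo_class_iff intro: wo_measurable_diff)

lemma wo_smult_class:
  assumes "a \<in> borel_measurable M" "f \<in> wo_measurable M"
  shows "wo_smult M (L0_class M a) (wo_class M f) = wo_class M (\<lambda>s. a s *\<^sub>C f s)"
  unfolding wo_smult_def using assms
  by (intro wo_lift2_eq) (auto simp: mem_wo_class_iff mem_L0_class_iff intro: wo_measurable_scaleC)

lemma wo_scale_class: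
  assumes "f \<in> wo_measurable M"
  shows "wo_scale M c (wo_class M f) = wo_class M (\<lambda>s. c *\<^sub>C f s)"
  unfolding wo_scale_def using assms by (intro wo_smult_class) auto

lemma (in norming_sequence) wo_mult_class:
  fixes f g :: "'s \<Rightarrow> 'a \<Rightarrow>\<^sub>L 'a"
  assumes "f \<in> wo_measurable M" "g \<in> wo_measurable M"
  shows "wo_mult M (wo_class M f) (wo_class M g) = wo_class M (\<lambda>s. f s o\<^sub>L g s)"
  unfolding wo_mult_def using assms
  by (intro wo_lift2_eq) (auto simp: mem_wo_class_iff intro: wo_measurable_compose)

lemma ess_norm_le:
  fixes F :: "('s \<Rightarrow> 'b::real_normed_vector) set"
  assumes f: "f \<in> F"
    and F: "\<And>f'. f' \<in> F \<Longrightarrow> (\<lambda>s. norm (f' s)) \<in> borel_measurable M \<and> (AE s in M. f s = f' s)"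
    and le: "\<And>s. s \<in> space M \<Longrightarrow> norm (f s) \<le> C"
  shows "ess_norm M F \<le> ereal C"
proof -
  have meas: "(\<lambda>s. ereal (norm (f' s))) \<in> borel_measurable M" if "f' \<in> F" for f'
    using F[OF that] by (intro borel_measurable_ereal) auto
  define e where "e = esssup M (\<lambda>s. ereal (norm (f s)))"
  have "esssup M (\<lambda>s. ereal (norm (f' s))) = e" if "f' \<in> F" for f'
    unfolding e_def using F[OF that] by (intro esssup_AE_cong meas that f) auto
  then have "(\<lambda>f'. esssup M (\<lambda>s. ereal (norm (f' s)))) ` F = {e}"
    using f by auto
  then have "ess_norm M F = e"
    unfolding ess_norm_def by simp
  also have "e \<le> ereal C"
    unfolding e_def by (rule esssup_I[OF meas[OF f]], rule AE_I2) (simp add: le)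
  finally show ?thesis .
qed

lemma (in norming_sequence) ess_norm_wo_class_le:
  fixes f :: "'s \<Rightarrow> 'a \<Rightarrow>\<^sub>L 'a"
  assumes "f \<in> wo_measurable M" "\<And>s. s \<in> space M \<Longrightarrow> norm (f s) \<le> C"
  shows "ess_norm M (wo_class M f) \<le> ereal C"
  using assms by (intro ess_norm_le[of f]) (auto simp: mem_wo_class_iff intro: norm_wo_measurable)

lemma bounded_in_Linf:
  assumes a: "a \<in> borel_measurable M" "\<And>s. s \<in> space M \<Longrightarrow> cmod (a s) \<le> C"
  shows "L0_class M a \<in> Linf M"
proof -
  have "ess_norm M (L0_class M a) \<le> ereal C"
    using a by (intro ess_norm_le[of a]) (auto simp: mem_L0_class_iff)
  then show ?thesis
    using a by (auto simp: Linf_def L0_def L0_class_def quotient_def)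
qed

lemma (in norming_sequence) bounded_in_Linf_wo:
  fixes f :: "'s \<Rightarrow> 'a \<Rightarrow>\<^sub>L 'a"
  assumes "f \<in> wo_measurable M" "\<And>s. s \<in> space M \<Longrightarrow> norm (f s) \<le> C"
  shows "wo_class M f \<in> Linf_wo M bounded_ops"
  using ess_norm_wo_class_le[OF assms] wo_class_in_L0_wo[OF assms(1)]
  by (auto simp: Linf_wo_def)

section \<open>Rank one and diagonal operators\<close>

definition rank_one :: "'a::complex_banach \<Rightarrow> ('a \<Rightarrow>\<^sub>L complex) \<Rightarrow> 'a \<Rightarrow>\<^sub>L 'a" where
  "rank_one x \<phi> = Blinfun (\<lambda>v. \<phi> v *\<^sub>C x)"

lemma rank_one_apply: "rank_one x \<phi> v = \<phi> v *\<^sub>C x"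
proof -
  have "bounded_linear (\<lambda>v. \<phi> v *\<^sub>C x)"
  proof (rule bounded_linear_intro)
    show "\<phi> (v + w) *\<^sub>C x = \<phi> v *\<^sub>C x + \<phi> w *\<^sub>C x" for v w
      by (simp add: blinfun.add_right scaleC_add_left)
    show "\<phi> (r *\<^sub>R v) *\<^sub>C x = r *\<^sub>R (\<phi> v *\<^sub>C x)" for r v
    proof -
      have "\<phi> (r *\<^sub>R v) *\<^sub>C x = (complex_of_real r * \<phi> v) *\<^sub>C x"
        by (simp add: blinfun.scaleR_right scaleR_conv_of_real)
      also have "\<dots> = r *\<^sub>R (\<phi> v *\<^sub>C x)"
        by (simp only: scaleC_of_real flip: scaleC_scaleC)
      finally show ?thesis .
    qed
    show "norm (\<phi> v *\<^sub>C x) \<le> norm v * (norm \<phi> * norm x)" for v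
      using mult_right_mono[OF norm_blinfun[of \<phi> v] norm_ge_zero[of x]]
      by (simp add: norm_scaleC mult_ac)
  qed
  then show ?thesis by (simp add: rank_one_def bounded_linear_Blinfun_apply)
qed

lemma norm_rank_one_le: "norm (rank_one x \<phi>) \<le> norm x * norm \<phi>"
proof (rule norm_blinfun_bound)
  show "norm (rank_one x \<phi> v) \<le> norm x * norm \<phi> * norm v" for v
    using mult_right_mono[OF norm_blinfun[of \<phi> v] norm_ge_zero[of x]]
    by (simp add: rank_one_apply norm_scaleC mult_ac)
qed simp

lemma rank_one_bounded_ops: "\<phi> \<in> bounded_ops \<Longrightarrow> rank_one x \<phi> \<in> bounded_ops"
  by (simp add: bounded_ops_def rank_one_apply scaleC_complex_def scaleC_scaleC)

lemma wo_measurable_rank_one: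
  assumes "weakly_measurable M y" "\<phi> \<in> bounded_ops"
  shows "(\<lambda>s. rank_one (y s) \<phi>) \<in> wo_measurable M"
  using assms
  by (intro wo_measurableI) (auto simp: rank_one_apply rank_one_bounded_ops intro!: weakly_measurable_scaleC)

lemma sum_rank_one_idempotent:
  fixes x :: "nat \<Rightarrow> 'a::complex_banach"
  assumes \<phi>: "\<And>i. i < N \<Longrightarrow> \<phi> i \<in> bounded_ops"
    and dual: "\<And>i j. i < N \<Longrightarrow> j < N \<Longrightarrow> \<phi> i (x j) = (if i = j then 1 else 0)"
  shows "(\<Sum>i<N. rank_one (x i) (\<phi> i)) \<in> finite_rank_idempotents"
proof -
  define p where "p = (\<Sum>i<N. rank_one (x i) (\<phi> i))"
  have p: "p v = (\<Sum>i<N. \<phi> i v *\<^sub>C x i)" for v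
    by (simp add: p_def blinfun.sum_left rank_one_apply)
  have bo: "p \<in> bounded_ops"
    unfolding p_def by (intro bounded_ops_sum rank_one_bounded_ops \<phi>) simp
  have px: "p (x j) = x j" if "j < N" for j
  proof -
    have "(\<Sum>i<N. \<phi> i (x j) *\<^sub>C x i) = (\<Sum>i<N. if i = j then x j else 0)"
      using that by (intro sum.cong) (auto simp: dual scaleC_one)
    then show ?thesis using that by (simp add: p)
  qed
  have "p (p v) = p v" for v
    unfolding p[of v] by (simp add: blinfun.sum_right bounded_opsD[OF bo] px)
  then have "p o\<^sub>L p = p" by (intro blinfun_eqI) simp
  moreover have "range p = complex_vector.span (x ` {..<N})"
  proof
    show "range p \<subseteq> complex_vector.span (x ` {..<N})"
    proof
      fix z assume "z \<in> range p"
      then obtain v where z: "z = p v" by blast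
      show "z \<in> complex_vector.span (x ` {..<N})"
        unfolding z p
        by (intro complex_vector.span_sum complex_vector.span_scale complex_vector.span_base) simp
    qed
    have "complex_vector.subspace (range p)"
      unfolding complex_vector.subspace_def
    proof (intro conjI ballI allI)
      show "0 \<in> range p" by (rule range_eqI[of _ _ 0]) simp
      show "v + w \<in> range p" if "v \<in> range p" "w \<in> range p" for v w
        using that by (auto simp flip: blinfun.add_right)
      show "c *\<^sub>C v \<in> range p" if "v \<in> range p" for c v
        using that by (auto simp flip: bounded_opsD[OF bo])
    qed
    moreover have "x ` {..<N} \<subseteq> range p" using px by (metis image_subsetI lessThan_iff rangeI)
    ultimately show "complex_vector.span (x ` {..<N}) \<subseteq> range p"
      by (intro complex_vector.span_minimal)
  qed
  ultimately have "p \<in> finite_rank_idempotents"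
    unfolding finite_rank_idempotents_def finite_rank_ops_def using bo by blast
  then show ?thesis by (simp add: p_def)
qed

text \<open>
  An idempotent with the same kernel as \<open>\<phi>\<close> absorbs all rank one operators built from \<open>\<phi>\<close>,
  whatever the vector. Therefore a field \<open>y(s) \<otimes> \<phi>\<close> is approximable by finite rank idempotents
  even though \<open>y\<close> may be far from having a finite-dimensional or relatively compact range.
\<close>

lemma exists_idempotent_same_kernel:
  fixes \<phi> :: "'a::complex_banach \<Rightarrow>\<^sub>L complex"
  assumes \<phi>: "\<phi> \<in> bounded_ops"
  shows "\<exists>p\<in>finite_rank_idempotents. \<forall>y. rank_one y \<phi> o\<^sub>L (id_blinfun - p) = 0"
proof (cases "\<phi> = 0")
  case True
  have "(0 :: 'a \<Rightarrow>\<^sub>L 'a) \<in> finite_rank_idempotents"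
    using sum_rank_one_idempotent[of 0] by simp
  moreover have "rank_one y \<phi> o\<^sub>L (id_blinfun - 0) = 0" for y
    using True by (intro blinfun_eqI) (simp add: rank_one_apply)
  ultimately show ?thesis by blast
next
  case False
  then obtain v where v: "\<phi> v \<noteq> 0" using blinfun_eqI[of \<phi> 0] by auto
  define x where "x = inverse (\<phi> v) *\<^sub>C v"
  have x: "\<phi> x = 1" using v by (simp add: x_def functional_scaleC[OF \<phi>])
  have "rank_one x \<phi> \<in> finite_rank_idempotents"
    using sum_rank_one_idempotent[of 1 "\<lambda>_. \<phi>" "\<lambda>_. x"] \<phi> x by simp
  moreover have "rank_one y \<phi> o\<^sub>L (id_blinfun - rank_one x \<phi>) = 0" for y
    by (intro blinfun_eqI)
       (simp add: rank_one_apply blinfun.diff_left blinfun.diff_right functional_scaleC[OF \<phi>] x)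
  ultimately show ?thesis by blast
qed

text \<open>
  Fields \<open>\<Sum>\<^sub>n c\<^sub>n(s) (x\<^sub>n \<otimes> \<phi>\<^sub>n)\<close> whose terms decay geometrically in norm, uniformly in \<open>s\<close>.
\<close>

locale diagonal_operator =
  fixes x :: "nat \<Rightarrow> 'a::complex_banach" and \<phi> :: "nat \<Rightarrow> 'a \<Rightarrow>\<^sub>L complex"
    and M :: "'s measure" and c :: "nat \<Rightarrow> 's \<Rightarrow> complex"
  assumes biorthogonal: "biorthogonal x \<phi>"
    and c_measurable: "c n \<in> borel_measurable M"
    and c_small: "s \<in> space M \<Longrightarrow> cmod (c n s) * (norm (x n) * norm (\<phi> n)) \<le> (1/2) ^ n"
begin

definition diag :: "'s \<Rightarrow> 'a \<Rightarrow>\<^sub>L 'a" where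
  "diag s = (\<Sum>n. c n s *\<^sub>C rank_one (x n) (\<phi> n))"

lemma \<phi>_bounded_ops: "\<phi> n \<in> bounded_ops"
  and \<phi>_x: "\<phi> m (x n) = (if m = n then 1 else 0)"
  using biorthogonal by (auto simp: biorthogonal_def)

lemma term_le:
  assumes "s \<in> space M"
  shows "norm (c n s *\<^sub>C rank_one (x n) (\<phi> n)) \<le> (1/2) ^ n"
proof -
  have "norm (c n s *\<^sub>C rank_one (x n) (\<phi> n)) \<le> cmod (c n s) * (norm (x n) * norm (\<phi> n))"
    by (simp add: norm_scaleC mult_left_mono norm_rank_one_le)
  also have "\<dots> \<le> (1/2) ^ n" by (rule c_small[OF assms])
  finally show ?thesis .
qed

lemma diag_summable: "s \<in> space M \<Longrightarrow> summable (\<lambda>n. c n s *\<^sub>C rank_one (x n) (\<phi> n))"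
  by (rule summable_comparison_test'[of "\<lambda>n. (1/2) ^ n" 0]) (auto simp: term_le summable_geometric)

lemma diag_apply_sums: "s \<in> space M \<Longrightarrow> (\<lambda>n. c n s *\<^sub>C \<phi> n v *\<^sub>C x n) sums diag s v"
proof -
  assume s: "s \<in> space M"
  have "(\<lambda>n. (c n s *\<^sub>C rank_one (x n) (\<phi> n)) v) sums diag s v"
    unfolding diag_def
    by (rule bounded_linear.sums[OF blinfun.bounded_linear_left summable_sums[OF diag_summable[OF s]]])
  then show ?thesis by (simp add: scaleC_blinfun_apply rank_one_apply)
qed

lemma diag_tail_le:
  assumes s: "s \<in> space M"
  shows "norm (diag s - (\<Sum>n<N. c n s *\<^sub>C rank_one (x n) (\<phi> n))) \<le> 2 * (1/2) ^ N"
proof -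
  let ?t = "\<lambda>n. c n s *\<^sub>C rank_one (x n) (\<phi> n)"
  have "diag s - sum ?t {..<N} = (\<Sum>n. ?t (n + N))"
    unfolding diag_def using suminf_minus_initial_segment[OF diag_summable[OF s]] by simp
  also have "norm \<dots> \<le> (\<Sum>n. (1/2) ^ (n + N))"
    by (rule norm_suminf_le) (auto simp: term_le[OF s] intro!: summable_ignore_initial_segment)
  also have "(\<Sum>n. (1/2::real) ^ (n + N)) = (\<Sum>n. (1/2) ^ n) * (1/2) ^ N"
    by (simp add: power_add suminf_mult2 summable_geometric)
  also have "\<dots> = 2 * (1/2) ^ N" by (simp add: suminf_geometric)
  finally show ?thesis .
qed

lemma diag_wo_measurable: "diag \<in> wo_measurable M"
proof (rule wo_measurableI)
  show "diag s \<in> bounded_ops" if s: "s \<in> space M" for s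
    unfolding bounded_ops_def
  proof safe
    fix a v
    have "(\<lambda>n. a *\<^sub>C c n s *\<^sub>C \<phi> n v *\<^sub>C x n) sums (a *\<^sub>C diag s v)"
      by (rule bounded_linear.sums[OF bounded_linear_scaleC diag_apply_sums[OF s]])
    then have "(\<lambda>n. c n s *\<^sub>C \<phi> n (a *\<^sub>C v) *\<^sub>C x n) sums (a *\<^sub>C diag s v)"
      by (simp add: functional_scaleC[OF \<phi>_bounded_ops] scaleC_scaleC mult_ac)
    then show "diag s (a *\<^sub>C v) = a *\<^sub>C diag s v"
      using diag_apply_sums[OF s] sums_unique2 by blast
  qed
  show "weakly_measurable M (\<lambda>s. diag s v)" for v
  proof (rule weakly_measurable_limit)
    show "weakly_measurable M (\<lambda>s. \<Sum>n<N. c n s *\<^sub>C \<phi> n v *\<^sub>C x n)" for N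
      by (induction N)
         (auto intro!: weakly_measurable_add weakly_measurable_scaleC weakly_measurable_const
            borel_measurable_times c_measurable)
    show "(\<lambda>N. \<Sum>n<N. c n s *\<^sub>C \<phi> n v *\<^sub>C x n) \<longlonglongrightarrow> diag s v" if "s \<in> space M" for s
      using diag_apply_sums[OF that] by (simp add: sums_def)
  qed
qed

lemma norm_diag_le: "s \<in> space M \<Longrightarrow> norm (diag s) \<le> 2"
  using diag_tail_le[of s 0] by simp

lemma diag_x: "s \<in> space M \<Longrightarrow> diag s (x n) = c n s *\<^sub>C x n"
proof -
  assume s: "s \<in> space M"
  have "(\<lambda>m. c m s *\<^sub>C \<phi> m (x n) *\<^sub>C x m) = (\<lambda>m. if m = n then c n s *\<^sub>C x n else 0)"
    by (auto simp: \<phi>_x scaleC_one)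
  then show ?thesis
    using diag_apply_sums[OF s, of "x n"] sums_single[of n "\<lambda>_. c n s *\<^sub>C x n"] sums_unique2
    by metis
qed

lemma \<phi>_diag: "s \<in> space M \<Longrightarrow> \<phi> n (diag s v) = c n s * \<phi> n v"
proof -
  assume s: "s \<in> space M"
  have "(\<lambda>m. \<phi> n (c m s *\<^sub>C \<phi> m v *\<^sub>C x m)) = (\<lambda>m. if m = n then c n s * \<phi> n v else 0)"
    by (auto simp: functional_scaleC[OF \<phi>_bounded_ops] \<phi>_x)
  moreover have "(\<lambda>m. \<phi> n (c m s *\<^sub>C \<phi> m v *\<^sub>C x m)) sums \<phi> n (diag s v)"
    by (rule bounded_linear.sums[OF blinfun.bounded_linear_right diag_apply_sums[OF s]])
  ultimately show ?thesis
    using sums_single[of n "\<lambda>_. c n s * \<phi> n v"] sums_unique2 by metis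
qed

text \<open>
  With \<open>p\<close> the idempotent onto the span of the first \<open>N\<close> vectors, composing with \<open>id_blinfun - p\<close>
  leaves the tail of the series.
\<close>

lemma diag_approximable:
  assumes "0 < \<epsilon>"
  shows "\<exists>p\<in>finite_rank_idempotents. \<forall>s\<in>space M. norm (diag s o\<^sub>L (id_blinfun - p)) \<le> \<epsilon>"
proof -
  obtain N where N: "(1/2 :: real) ^ N < \<epsilon> / 2"
    using real_arch_pow_inv[of "\<epsilon> / 2" "1/2"] assms by auto
  define p where "p = (\<Sum>n<N. rank_one (x n) (\<phi> n))"
  have p: "p v = (\<Sum>n<N. \<phi> n v *\<^sub>C x n)" for v
    by (simp add: p_def blinfun.sum_left rank_one_apply)
  have "p \<in> finite_rank_idempotents"
    unfolding p_def by (rule sum_rank_one_idempotent) (auto simp: \<phi>_bounded_ops \<phi>_x)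
  moreover have "norm (diag s o\<^sub>L (id_blinfun - p)) \<le> \<epsilon>" if s: "s \<in> space M" for s
  proof -
    have bo: "diag s \<in> bounded_ops" using diag_wo_measurable s by (rule wo_measurable_bounded_ops)
    have "diag s o\<^sub>L (id_blinfun - p) = diag s - (\<Sum>n<N. c n s *\<^sub>C rank_one (x n) (\<phi> n))"
    proof (rule blinfun_eqI)
      fix v
      have "diag s (p v) = (\<Sum>n<N. c n s *\<^sub>C \<phi> n v *\<^sub>C x n)"
        by (simp add: p blinfun.sum_right bounded_opsD[OF bo] diag_x[OF s] scaleC_scaleC mult_ac)
      then show "(diag s o\<^sub>L (id_blinfun - p)) v = (diag s - (\<Sum>n<N. c n s *\<^sub>C rank_one (x n) (\<phi> n))) v"
        by (simp add: blinfun.diff_left blinfun.diff_right blinfun.sum_left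
            scaleC_blinfun_apply rank_one_apply)
    qed
    then show ?thesis using diag_tail_le[OF s, of N] N by simp
  qed
  ultimately show ?thesis by blast
qed

end

section \<open>Bounded measurable fields\<close>

definition bdd_measurable :: "'s measure \<Rightarrow> ('s \<Rightarrow> complex) \<Rightarrow> bool" where
  "bdd_measurable M a \<longleftrightarrow> a \<in> borel_measurable M \<and> (\<exists>C. \<forall>s\<in>space M. cmod (a s) \<le> C)"

definition bdd_weakly_measurable :: "'s measure \<Rightarrow> ('s \<Rightarrow> 'a::complex_banach) \<Rightarrow> bool" where
  "bdd_weakly_measurable M y \<longleftrightarrow> weakly_measurable M y \<and> (\<exists>C. \<forall>s\<in>space M. norm (y s) \<le> C)"

lemma bdd_measurable_const: "bdd_measurable M (\<lambda>_. c)"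
  by (auto simp: bdd_measurable_def)

lemma bdd_measurable_add:
  assumes "bdd_measurable M a" "bdd_measurable M b" shows "bdd_measurable M (\<lambda>s. a s + b s)"
  using assms unfolding bdd_measurable_def
  by (auto intro!: borel_measurable_add) (meson add_mono norm_triangle_mono)

lemma bdd_measurable_mult:
  assumes a: "bdd_measurable M a" and b: "bdd_measurable M b" shows "bdd_measurable M (\<lambda>s. a s * b s)"
proof -
  obtain C D where "\<And>s. s \<in> space M \<Longrightarrow> cmod (a s) \<le> C" "\<And>s. s \<in> space M \<Longrightarrow> cmod (b s) \<le> D"
    using a b unfolding bdd_measurable_def by blast
  then have "cmod (a s * b s) \<le> \<bar>C\<bar> * \<bar>D\<bar>" if "s \<in> space M" for s
    unfolding norm_mult using that by (intro mult_mono) force+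
  then show ?thesis using a b unfolding bdd_measurable_def by (blast intro: borel_measurable_times)
qed

lemma bdd_measurable_indicator: "B \<in> sets M \<Longrightarrow> bdd_measurable M (indicator B)"
  unfolding bdd_measurable_def by (auto simp: indicator_def intro!: exI[of _ 1])

lemma bdd_weakly_measurable_const: "bdd_weakly_measurable M (\<lambda>_. x)"
  by (auto simp: bdd_weakly_measurable_def weakly_measurable_const)

lemma bdd_weakly_measurable_scaleC:
  assumes a: "bdd_measurable M a" and y: "bdd_weakly_measurable M y"
  shows "bdd_weakly_measurable M (\<lambda>s. a s *\<^sub>C y s)"
proof -
  obtain C D where "\<And>s. s \<in> space M \<Longrightarrow> cmod (a s) \<le> C" "\<And>s. s \<in> space M \<Longrightarrow> norm (y s) \<le> D"
    using a y unfolding bdd_measurable_def bdd_weakly_measurable_def by blast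
  then have "norm (a s *\<^sub>C y s) \<le> \<bar>C\<bar> * \<bar>D\<bar>" if "s \<in> space M" for s
    unfolding norm_scaleC using that by (intro mult_mono) force+
  then show ?thesis using a y unfolding bdd_measurable_def bdd_weakly_measurable_def
    by (blast intro: weakly_measurable_scaleC)
qed

lemma bdd_measurable_functional:
  fixes \<phi> :: "'a::complex_banach \<Rightarrow>\<^sub>L complex"
  assumes y: "bdd_weakly_measurable M y" and \<phi>: "\<phi> \<in> bounded_ops"
  shows "bdd_measurable M (\<lambda>s. \<phi> (y s))"
proof -
  obtain C where C: "\<And>s. s \<in> space M \<Longrightarrow> norm (y s) \<le> C"
    using y unfolding bdd_weakly_measurable_def by blast
  have "cmod (\<phi> (y s)) \<le> norm \<phi> * C" if "s \<in> space M" for s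
    using norm_blinfun[of \<phi> "y s"] mult_left_mono[OF C[OF that] norm_ge_zero[of \<phi>]] by simp
  then show ?thesis
    using y \<phi> unfolding bdd_measurable_def bdd_weakly_measurable_def
    by (blast intro: weakly_measurableD)
qed

lemma exists_countable_approximation_complex:
  assumes a: "bdd_measurable M a" and \<epsilon>: "0 < \<epsilon>"
  shows "\<exists>(r :: nat \<Rightarrow> complex) \<kappa>. \<kappa> \<in> M \<rightarrow>\<^sub>M count_space UNIV \<and>
    bdd_measurable M (\<lambda>s. r (\<kappa> s)) \<and> (\<forall>s. cmod (a s - r (\<kappa> s)) < \<epsilon>)"
proof -
  obtain Q :: "complex set" where Q: "countable Q" "\<And>X. open X \<Longrightarrow> X \<noteq> {} \<Longrightarrow> \<exists>z\<in>Q. z \<in> X"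
    by (rule countable_dense_setE) blast
  have "closure Q = UNIV"
    using Q(2)[of "- closure Q"] closure_subset[of Q] by auto
  then have "separable_space (euclidean :: complex topology)"
    using Q(1) by (auto simp: separable_space_def)
  then obtain r :: "nat \<Rightarrow> complex" and \<psi> where "norming_sequence r \<psi>"
    using exists_norming_sequence by blast
  then interpret norming_sequence r \<psi> .
  have am: "a \<in> borel_measurable M" using a by (simp add: bdd_measurable_def)
  have "weakly_measurable M a"
  proof (rule weakly_measurableI)
    fix \<phi> :: "complex \<Rightarrow>\<^sub>L complex"
    have "continuous_on UNIV (blinfun_apply \<phi>)" by (intro continuous_intros)
    then show "(\<lambda>s. \<phi> (a s)) \<in> borel_measurable M"
      using am by (rule borel_measurable_continuous_on)
  qed
  then obtain \<kappa> where \<kappa>: "\<kappa> \<in> M \<rightarrow>\<^sub>M count_space UNIV" "\<And>s. norm (a s - r (\<kappa> s)) < \<epsilon>"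
    using exists_countable_approximation[OF _ \<epsilon>] by blast
  obtain C where C: "\<And>s. s \<in> space M \<Longrightarrow> cmod (a s) \<le> C"
    using a by (auto simp: bdd_measurable_def)
  have "cmod (r (\<kappa> s)) \<le> C + \<epsilon>" if "s \<in> space M" for s
    using norm_triangle_sub[of "r (\<kappa> s)" "a s"] C[OF that] \<kappa>(2)[of s]
    by (simp add: norm_minus_commute)
  moreover have "(\<lambda>s. r (\<kappa> s)) \<in> borel_measurable M"
    using \<kappa>(1) by (rule measurable_compose) simp
  ultimately show ?thesis using \<kappa> unfolding bdd_measurable_def by blast
qed

lemma AE_allI: "(\<And>n::nat. AE s in M. P n s) \<Longrightarrow> AE s in M. \<forall>n. P n s"
  by (simp add: AE_all_countable)

text \<open>
  The vectors \<open>x\<close> at which the numbers \<open>l j x\<close> are the \<open>\<psi> j\<close>-coordinates of some vector form a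
  closed set: the bound \<open>C\<close> turns Cauchy sequences of such \<open>x\<close> into Cauchy sequences, because the
  \<open>\<psi> j\<close> are norming. So it is enough to check the dense sequence.
\<close>

lemma (in norming_sequence) exists_operator_from_functionals:
  fixes l :: "nat \<Rightarrow> 'a \<Rightarrow>\<^sub>L complex"
  assumes l: "\<And>j. l j \<in> bounded_ops" and C: "\<And>j. norm (l j) \<le> C"
    and ex: "\<And>k. \<exists>z. \<forall>j. \<psi> j z = l j (q k)"
  shows "\<exists>T\<in>bounded_ops. \<forall>x j. \<psi> j (T x) = l j x"
proof -
  have C0: "0 \<le> C" using C[of 0] norm_ge_zero order_trans by blast
  have bound: "norm z \<le> C * norm x" if "\<And>j. \<psi> j z = l j x" for z x
  proof (rule norm_le_of_norming)
    show "cmod (\<psi> j z) \<le> C * norm x" for j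
      using norm_blinfun[of "l j" x] mult_right_mono[OF C[of j] norm_ge_zero[of x]] that[of j] by simp
  qed
  have "closed {x. \<exists>z. \<forall>j. \<psi> j z = l j x}"
    unfolding closed_sequential_limits
  proof safe
    fix X x assume X: "\<forall>n. X n \<in> {x. \<exists>z. \<forall>j. \<psi> j z = l j x}" and lim: "X \<longlonglongrightarrow> x"
    from X obtain z where z: "\<And>n j. \<psi> j (z n) = l j (X n)" by simp metis
    have diff: "norm (z m - z n) \<le> C * norm (X m - X n)" for m n
      by (rule bound) (simp add: blinfun.diff_right z)
    have "Cauchy z"
    proof (rule CauchyI)
      fix \<epsilon> :: real assume \<epsilon>: "0 < \<epsilon>"
      have "Cauchy X" using lim by (rule LIMSEQ_imp_Cauchy)
      then obtain N where N: "\<And>m n. m \<ge> N \<Longrightarrow> n \<ge> N \<Longrightarrow> norm (X m - X n) < \<epsilon> / (C + 1)"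
        using CauchyD[of X "\<epsilon> / (C + 1)"] \<epsilon> C0 by auto
      have "norm (z m - z n) < \<epsilon>" if "m \<ge> N" "n \<ge> N" for m n
      proof -
        have "norm (z m - z n) \<le> (C + 1) * norm (X m - X n)"
          using diff[of m n] norm_ge_zero[of "X m - X n"] unfolding distrib_right by linarith
        also have "\<dots> < \<epsilon>" using N[OF that] C0 by (simp add: field_simps)
        finally show ?thesis .
      qed
      then show "\<exists>N. \<forall>m\<ge>N. \<forall>n\<ge>N. norm (z m - z n) < \<epsilon>" by blast
    qed
    then obtain w where w: "z \<longlonglongrightarrow> w" by (auto simp: Cauchy_convergent_iff convergent_def)
    have "\<psi> j w = l j x" for j
    proof (rule LIMSEQ_unique)
      show "(\<lambda>n. \<psi> j (z n)) \<longlonglongrightarrow> \<psi> j w" by (intro tendsto_intros w)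
      show "(\<lambda>n. \<psi> j (z n)) \<longlonglongrightarrow> l j x" unfolding z by (intro tendsto_intros lim)
    qed
    then show "\<exists>z. \<forall>j. \<psi> j z = l j x" by blast
  qed
  then have "\<exists>z. \<forall>j. \<psi> j z = l j x" for x
    using closed_of_dense[of "{x. \<exists>z. \<forall>j. \<psi> j z = l j x}" x] ex by blast
  then obtain t where t: "\<And>x j. \<psi> j (t x) = l j x" by metis
  have tC: "t (c *\<^sub>C x) = c *\<^sub>C t x" for c x
    by (rule eq_of_norming) (simp add: t functional_scaleC \<psi>_bounded_ops l)
  have "bounded_linear t"
  proof (rule bounded_linear_intro)
    show "t (x + y) = t x + t y" for x y
      by (rule eq_of_norming) (simp add: t blinfun.add_right)
    show "t (r *\<^sub>R x) = r *\<^sub>R t x" for r x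
      by (rule eq_of_norming) (simp add: t blinfun.scaleR_right)
    show "norm (t x) \<le> norm x * C" for x
      using bound[OF t, of x] by (simp add: mult.commute)
  qed
  then have "Blinfun t x = t x" for x by (simp add: bounded_linear_Blinfun_apply)
  then show ?thesis
    using t tC by (intro bexI[of _ "Blinfun t"]) (auto simp: bounded_ops_def)
qed

section \<open>Derivations of algebras of operator-valued functions\<close>

text \<open>
  A derivation written in terms of representatives: \<open>Fn\<close> consists of the functions whose class
  belongs to the algebra, and \<open>d\<close> picks a representative of the image. The set \<open>A\<close> is fixed, and
  all conclusions concern its points only, since the indicator of a set of infinite measure times
  a rank one operator may fail to lie in the algebra.
\<close>

locale function_derivation = norming_sequence q \<psi>
  for q :: "nat \<Rightarrow> 'a::complex_banach" and \<psi> +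
  fixes M :: "'s measure" and A :: "'s set"
    and Fn :: "('s \<Rightarrow> 'a \<Rightarrow>\<^sub>L 'a) set" and d :: "('s \<Rightarrow> 'a \<Rightarrow>\<^sub>L 'a) \<Rightarrow> 's \<Rightarrow> 'a \<Rightarrow>\<^sub>L 'a"
    and e :: 'a and \<phi> :: "'a \<Rightarrow>\<^sub>L complex"
  assumes infinite_dimensional: "infinite_dimensional TYPE('a)"
    and complete: "complete_measure M"
    and A: "A \<in> sets M"
    and \<phi>: "\<phi> \<in> bounded_ops" and \<phi>_e: "\<phi> e = 1"
    and Fn_wo_measurable: "f \<in> Fn \<Longrightarrow> f \<in> wo_measurable M"
    and d_wo_measurable: "f \<in> Fn \<Longrightarrow> d f \<in> wo_measurable M"
    and Fn_add: "f \<in> Fn \<Longrightarrow> g \<in> Fn \<Longrightarrow> (\<lambda>s. f s + g s) \<in> Fn"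
    and Fn_mult: "f \<in> Fn \<Longrightarrow> g \<in> Fn \<Longrightarrow> (\<lambda>s. f s o\<^sub>L g s) \<in> Fn"
    and Fn_scaleC: "bdd_measurable M a \<Longrightarrow> f \<in> Fn \<Longrightarrow> (\<lambda>s. a s *\<^sub>C f s) \<in> Fn"
    and Fn_approximable: "f \<in> wo_measurable M \<Longrightarrow> (\<And>s. s \<in> space M \<Longrightarrow> norm (f s) \<le> C) \<Longrightarrow>
      (\<And>\<epsilon>. 0 < \<epsilon> \<Longrightarrow>
        \<exists>p\<in>finite_rank_idempotents. \<forall>s\<in>space M. norm (f s o\<^sub>L (id_blinfun - p)) \<le> \<epsilon>) \<Longrightarrow>
      (\<lambda>s. indicator A s *\<^sub>C f s) \<in> Fn"
    and d_cong: "f \<in> Fn \<Longrightarrow> g \<in> Fn \<Longrightarrow> AE s in M. f s = g s \<Longrightarrow> AE s in M. d f s = d g s"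
    and d_add: "f \<in> Fn \<Longrightarrow> g \<in> Fn \<Longrightarrow> AE s in M. d (\<lambda>s. f s + g s) s = d f s + d g s"
    and d_scaleC: "f \<in> Fn \<Longrightarrow> AE s in M. d (\<lambda>s. c *\<^sub>C f s) s = c *\<^sub>C d f s"
    and d_mult: "f \<in> Fn \<Longrightarrow> g \<in> Fn \<Longrightarrow>
      AE s in M. d (\<lambda>s. f s o\<^sub>L g s) s = (d f s o\<^sub>L g s) + (f s o\<^sub>L d g s)"
begin

lemma Fn_scaleC_const: "f \<in> Fn \<Longrightarrow> (\<lambda>s. c *\<^sub>C f s) \<in> Fn"
  by (rule Fn_scaleC[OF bdd_measurable_const])

lemma Fn_apply_bdd:
  assumes "f \<in> Fn" "\<forall>s\<in>space M. norm (f s) \<le> C" and y: "bdd_weakly_measurable M y"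
  shows "bdd_weakly_measurable M (\<lambda>s. f s (y s))"
proof -
  obtain D where D: "\<And>s. s \<in> space M \<Longrightarrow> norm (y s) \<le> D"
    using y unfolding bdd_weakly_measurable_def by blast
  have "norm (f s (y s)) \<le> C * D" if s: "s \<in> space M" for s
  proof -
    have "norm (f s (y s)) \<le> norm (f s) * norm (y s)" by (rule norm_blinfun)
    also have "\<dots> \<le> C * D"
      using assms(2)[rule_format, OF s] D[OF s] order_trans[OF norm_ge_zero assms(2)[rule_format, OF s]]
      by (intro mult_mono) auto
    finally show ?thesis .
  qed
  then show ?thesis
    using wo_measurable_apply[OF Fn_wo_measurable[OF assms(1)]] y
    unfolding bdd_weakly_measurable_def by blast
qed

text \<open>
  The functions \<open>\<chi>\<^sub>A (y \<otimes> \<eta>)\<close>. They lie in the algebra for all bounded measurable \<open>y\<close>, and they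
  are the probes by which \<open>d\<close> is analysed.
\<close>

definition R :: "('s \<Rightarrow> 'a) \<Rightarrow> ('a \<Rightarrow>\<^sub>L complex) \<Rightarrow> 's \<Rightarrow> 'a \<Rightarrow>\<^sub>L 'a" where
  "R y \<eta> s = indicator A s *\<^sub>C rank_one (y s) \<eta>"

lemma R_apply: "R y \<eta> s v = indicator A s *\<^sub>C \<eta> v *\<^sub>C y s"
  by (simp add: R_def scaleC_blinfun_apply rank_one_apply)

lemma R_apply_in_A: "s \<in> A \<Longrightarrow> R y \<eta> s v = \<eta> v *\<^sub>C y s"
  by (simp add: R_apply scaleC_one)

lemma norm_R_le:
  assumes "norm (y s) \<le> C"
  shows "norm (R y \<eta> s) \<le> C * norm \<eta>"
proof -
  have "norm (R y \<eta> s) \<le> 1 * norm (rank_one (y s) \<eta>)"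
    unfolding R_def norm_scaleC by (intro mult_right_mono) (auto simp: indicator_def)
  also have "\<dots> \<le> norm (y s) * norm \<eta>" using norm_rank_one_le by simp
  also have "\<dots> \<le> C * norm \<eta>" using assms by (intro mult_right_mono) auto
  finally show ?thesis .
qed

lemma R_in_Fn:
  assumes y: "bdd_weakly_measurable M y" and \<eta>: "\<eta> \<in> bounded_ops"
  shows "R y \<eta> \<in> Fn"
proof -
  obtain C where C: "\<And>s. s \<in> space M \<Longrightarrow> norm (y s) \<le> C"
    using y unfolding bdd_weakly_measurable_def by blast
  obtain p where p: "p \<in> finite_rank_idempotents" "\<And>y. rank_one y \<eta> o\<^sub>L (id_blinfun - p) = 0"
    using exists_idempotent_same_kernel[OF \<eta>] by blast
  have "(\<lambda>s. indicator A s *\<^sub>C rank_one (y s) \<eta>) \<in> Fn"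
  proof (rule Fn_approximable)
    show "(\<lambda>s. rank_one (y s) \<eta>) \<in> wo_measurable M"
      using y \<eta> unfolding bdd_weakly_measurable_def by (blast intro: wo_measurable_rank_one)
    show "norm (rank_one (y s) \<eta>) \<le> C * norm \<eta>" if "s \<in> space M" for s
      using norm_rank_one_le[of "y s" \<eta>] mult_right_mono[OF C[OF that] norm_ge_zero[of \<eta>]] by simp
    show "\<exists>p\<in>finite_rank_idempotents. \<forall>s\<in>space M. norm (rank_one (y s) \<eta> o\<^sub>L (id_blinfun - p)) \<le> \<epsilon>"
      if "0 < \<epsilon>" for \<epsilon>
      using p that by (intro bexI[of _ p]) auto
  qed
  then show ?thesis by (simp add: R_def[abs_def])
qed

text \<open>
  If \<open>h = f - g\<close> vanishes on \<open>B\<close>, then \<open>h r = 0\<close> for every rank one \<open>r\<close> supported in \<open>B\<close>, and the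
  Leibniz rule leaves \<open>d h r = 0\<close> on \<open>B\<close>. There are enough such \<open>r\<close> to conclude \<open>d h = 0\<close> on
  \<open>A \<inter> B\<close>.
\<close>

lemma d_local:
  assumes f: "f \<in> Fn" and g: "g \<in> Fn" and B: "B \<in> sets M"
    and eq: "AE s in M. s \<in> B \<longrightarrow> f s = g s"
  shows "AE s in M. s \<in> A \<longrightarrow> s \<in> B \<longrightarrow> d f s = d g s"
proof -
  define h where "h s = f s + (- 1) *\<^sub>C g s" for s
  have g': "(\<lambda>s. (- 1) *\<^sub>C g s) \<in> Fn" by (rule Fn_scaleC_const[OF g])
  have h: "h \<in> Fn" unfolding h_def[abs_def] by (rule Fn_add[OF f g'])
  have dh: "AE s in M. d h s = d f s + (- 1) *\<^sub>C d g s"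
    using d_add[OF f g'] d_scaleC[OF g, of "- 1"] unfolding h_def[abs_def]
    by eventually_elim simp
  have minus: "(- 1) *\<^sub>C T = - T" for T :: "'a \<Rightarrow>\<^sub>L 'a"
    by (metis complex_vector.scale_minus_left scaleC_one)
  have "AE s in M. s \<in> A \<longrightarrow> s \<in> B \<longrightarrow> d h s (q k) = 0" for k
  proof -
    define r where "r s = indicator B s *\<^sub>C R (\<lambda>_. q k) \<phi> s" for s
    have r: "r \<in> Fn"
      unfolding r_def[abs_def]
      by (intro Fn_scaleC bdd_measurable_indicator B R_in_Fn bdd_weakly_measurable_const \<phi>)
    have hr: "(\<lambda>s. h s o\<^sub>L r s) \<in> Fn" by (rule Fn_mult[OF h r])
    \<comment> \<open>zero is written as a multiple of a member so that \<open>d_scaleC\<close> gives its image\<close>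
    have "AE s in M. h s o\<^sub>L r s = 0 *\<^sub>C (h s o\<^sub>L r s)"
      using eq
    proof eventually_elim
      fix s assume "s \<in> B \<longrightarrow> f s = g s"
      then have "s \<in> B \<Longrightarrow> h s = 0" by (simp add: h_def minus)
      then show "h s o\<^sub>L r s = 0 *\<^sub>C (h s o\<^sub>L r s)"
        by (cases "s \<in> B") (auto simp: r_def)
    qed
    from d_cong[OF hr Fn_scaleC_const[OF hr] this] d_scaleC[OF hr, of 0] d_mult[OF h r] eq
    show ?thesis
    proof eventually_elim
      case (elim s)
      show "s \<in> A \<longrightarrow> s \<in> B \<longrightarrow> d h s (q k) = 0"
      proof (intro impI)
        assume s: "s \<in> A" "s \<in> B"
        have "h s = 0" using elim s by (simp add: h_def minus)
        then have "d h s o\<^sub>L r s = 0" using elim by simp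
        then have "(d h s o\<^sub>L r s) e = 0" by simp
        then show "d h s (q k) = 0" using s by (simp add: r_def scaleC_one R_apply_in_A \<phi>_e)
      qed
    qed
  qed
  then have "AE s in M. \<forall>k. s \<in> A \<longrightarrow> s \<in> B \<longrightarrow> d h s (q k) = 0"
    by (rule AE_allI)
  then show ?thesis
    using dh
  proof eventually_elim
    case (elim s)
    show ?case
    proof (intro impI)
      assume "s \<in> A" "s \<in> B"
      then have "d h s = 0" using elim by (intro blinfun_eq_of_dense) simp
      then show "d f s = d g s" using elim by (simp add: minus)
    qed
  qed
qed

definition W :: "('s \<Rightarrow> 'a) \<Rightarrow> 's \<Rightarrow> 'a" where
  "W y s = d (R y \<phi>) s e"

lemma W_measurable: "bdd_weakly_measurable M y \<Longrightarrow> weakly_measurable M (W y)"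
  unfolding W_def[abs_def]
  by (intro wo_measurable_apply_const d_wo_measurable R_in_Fn \<phi>)

lemma W_cong_on:
  assumes "bdd_weakly_measurable M y" "bdd_weakly_measurable M z" "B \<in> sets M"
    and eq: "AE s in M. s \<in> A \<longrightarrow> s \<in> B \<longrightarrow> y s = z s"
  shows "AE s in M. s \<in> A \<longrightarrow> s \<in> B \<longrightarrow> W y s = W z s"
proof -
  have "AE s in M. s \<in> B \<longrightarrow> R y \<phi> s = R z \<phi> s"
    using eq by eventually_elim (auto simp: R_def indicator_def)
  from d_local[OF R_in_Fn[OF assms(1) \<phi>] R_in_Fn[OF assms(2) \<phi>] assms(3) this]
  show ?thesis by eventually_elim (simp add: W_def)
qed

lemma W_cong:
  assumes "bdd_weakly_measurable M y" "bdd_weakly_measurable M z"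
    and eq: "AE s in M. s \<in> A \<longrightarrow> y s = z s"
  shows "AE s in M. s \<in> A \<longrightarrow> W y s = W z s"
proof -
  have "AE s in M. s \<in> A \<longrightarrow> s \<in> A \<longrightarrow> W y s = W z s"
    using eq by (intro W_cong_on assms A) auto
  then show ?thesis by eventually_elim simp
qed

lemma W_add:
  assumes y: "bdd_weakly_measurable M y" and z: "bdd_weakly_measurable M z"
  shows "AE s in M. W (\<lambda>s. y s + z s) s = W y s + W z s"
proof -
  have "R (\<lambda>s. y s + z s) \<phi> = (\<lambda>s. R y \<phi> s + R z \<phi> s)"
    by (intro ext blinfun_eqI) (simp add: R_apply blinfun.add_left scaleC_add_right)
  then show ?thesis
    using d_add[OF R_in_Fn[OF y \<phi>] R_in_Fn[OF z \<phi>]]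
    by (auto elim!: eventually_mono simp: W_def blinfun.add_left)
qed

lemma W_scaleC:
  assumes y: "bdd_weakly_measurable M y"
  shows "AE s in M. W (\<lambda>s. c *\<^sub>C y s) s = c *\<^sub>C W y s"
proof -
  have "R (\<lambda>s. c *\<^sub>C y s) \<phi> = (\<lambda>s. c *\<^sub>C R y \<phi> s)"
    by (intro ext blinfun_eqI) (simp add: R_apply scaleC_blinfun_apply scaleC_scaleC mult_ac)
  then show ?thesis
    using d_scaleC[OF R_in_Fn[OF y \<phi>], of c]
    by (auto elim!: eventually_mono simp: W_def scaleC_blinfun_apply)
qed

text \<open>
  The Leibniz rule for \<open>f \<cdot> \<chi>\<^sub>A (y \<otimes> \<phi>) = \<chi>\<^sub>A (f y \<otimes> \<phi>)\<close>, evaluated at \<open>e\<close>. Everything that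
  follows comes from inserting suitable \<open>f\<close> and \<open>y\<close> here.
\<close>

lemma W_apply:
  assumes f: "f \<in> Fn" "\<forall>s\<in>space M. norm (f s) \<le> C" and y: "bdd_weakly_measurable M y"
  shows "AE s in M. s \<in> A \<longrightarrow> W (\<lambda>s. f s (y s)) s = d f s (y s) + f s (W y s)"
proof -
  have fy: "bdd_weakly_measurable M (\<lambda>s. f s (y s))" using f y by (rule Fn_apply_bdd)
  have Ry: "R y \<phi> \<in> Fn" using y \<phi> by (rule R_in_Fn)
  have "AE s in M. R (\<lambda>s. f s (y s)) \<phi> s = f s o\<^sub>L R y \<phi> s"
  proof (rule AE_I2)
    fix s assume "s \<in> space M"
    then have "f s \<in> bounded_ops" using Fn_wo_measurable[OF f(1)] by (intro wo_measurable_bounded_ops)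
    then show "R (\<lambda>s. f s (y s)) \<phi> s = f s o\<^sub>L R y \<phi> s"
      by (intro blinfun_eqI) (simp add: R_apply bounded_opsD)
  qed
  from d_cong[OF R_in_Fn[OF fy \<phi>] Fn_mult[OF f(1) Ry] this] d_mult[OF f(1) Ry]
  show ?thesis
    by eventually_elim (simp add: W_def blinfun.add_left R_apply_in_A \<phi>_e scaleC_one)
qed

text \<open>
  The defect of \<open>W\<close> from being linear over scalar functions, by \<open>W_scalar_mult\<close>.
\<close>

definition D :: "('s \<Rightarrow> complex) \<Rightarrow> 's \<Rightarrow> complex" where
  "D a s = \<phi> (W (\<lambda>s. a s *\<^sub>C e) s)"

text \<open>
  Insert \<open>f = \<chi>\<^sub>A (x \<otimes> \<phi>)\<close> and \<open>y = b e\<close>, so that \<open>f y = b x\<close> on \<open>A\<close>.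
\<close>

lemma W_scalar_mult:
  assumes b: "bdd_measurable M b"
  shows "AE s in M. s \<in> A \<longrightarrow> W (\<lambda>s. b s *\<^sub>C x) s = b s *\<^sub>C W (\<lambda>_. x) s + D b s *\<^sub>C x"
proof -
  let ?f = "R (\<lambda>_. x) \<phi>"
  have x: "bdd_weakly_measurable M (\<lambda>_. x)" by (rule bdd_weakly_measurable_const)
  have f: "?f \<in> Fn" by (rule R_in_Fn[OF x \<phi>])
  have bound: "\<forall>s\<in>space M. norm (?f s) \<le> norm x * norm \<phi>" by (simp add: norm_R_le)
  have be: "bdd_weakly_measurable M (\<lambda>s. b s *\<^sub>C e)"
    and bx: "bdd_weakly_measurable M (\<lambda>s. b s *\<^sub>C x)"
    by (intro bdd_weakly_measurable_scaleC b bdd_weakly_measurable_const)+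
  have "AE s in M. s \<in> A \<longrightarrow> ?f s (b s *\<^sub>C e) = b s *\<^sub>C x"
    by (simp add: R_apply_in_A functional_scaleC[OF \<phi>] \<phi>_e)
  from W_cong[OF Fn_apply_bdd[OF f bound be] bx this] W_apply[OF f bound be] AE_space[of M]
  show ?thesis
  proof eventually_elim
    case (elim s)
    show ?case
    proof
      assume s: "s \<in> A"
      have "d ?f s \<in> bounded_ops" using d_wo_measurable[OF f] elim(3) by (rule wo_measurable_bounded_ops)
      then have "d ?f s (b s *\<^sub>C e) = b s *\<^sub>C W (\<lambda>_. x) s" by (simp add: bounded_opsD W_def)
      then show "W (\<lambda>s. b s *\<^sub>C x) s = b s *\<^sub>C W (\<lambda>_. x) s + D b s *\<^sub>C x"
        using elim s by (simp add: R_apply_in_A D_def)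
    qed
  qed
qed

text \<open>
  The case \<open>b = 1\<close>, \<open>x = e\<close> of \<open>W_scalar_mult\<close> says \<open>D(1) e = 0\<close>.
\<close>

lemma \<phi>_W_e: "AE s in M. s \<in> A \<longrightarrow> \<phi> (W (\<lambda>_. e) s) = 0"
proof -
  have "e \<noteq> 0" using \<phi>_e by auto
  with W_scalar_mult[OF bdd_measurable_const, of 1 e] show ?thesis
    by (auto elim!: eventually_mono simp: scaleC_one D_def)
qed

text \<open>
  On each level set of \<open>\<kappa>\<close> the function agrees with a constant, where complex linearity of \<open>W\<close> and
  \<open>D(1) = 0\<close> apply.
\<close>

lemma D_countably_valued:
  assumes u: "bdd_measurable M (\<lambda>s. r (\<kappa> s))" and \<kappa>: "\<kappa> \<in> M \<rightarrow>\<^sub>M count_space (UNIV :: nat set)"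
  shows "AE s in M. s \<in> A \<longrightarrow> D (\<lambda>s. r (\<kappa> s)) s = 0"
proof -
  have "AE s in M. s \<in> A \<longrightarrow> \<kappa> s = k \<longrightarrow> D (\<lambda>s. r (\<kappa> s)) s = 0" for k
  proof -
    let ?B = "{s \<in> space M. \<kappa> s = k}"
    have B: "?B \<in> sets M" using \<kappa> by measurable
    have "AE s in M. s \<in> A \<longrightarrow> s \<in> ?B \<longrightarrow> W (\<lambda>s. r (\<kappa> s) *\<^sub>C e) s = W (\<lambda>s. r k *\<^sub>C e) s"
      by (intro W_cong_on bdd_weakly_measurable_scaleC u bdd_measurable_const
          bdd_weakly_measurable_const B) auto
    then show ?thesis
      using W_scaleC[OF bdd_weakly_measurable_const, of "r k" e] \<phi>_W_e AE_space[of M]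
      by eventually_elim (auto simp: D_def functional_scaleC[OF \<phi>])
  qed
  then have "AE s in M. \<forall>k. s \<in> A \<longrightarrow> \<kappa> s = k \<longrightarrow> D (\<lambda>s. r (\<kappa> s)) s = 0"
    by (rule AE_allI)
  then show ?thesis by eventually_elim simp
qed

lemma D_add:
  assumes "bdd_measurable M a" "bdd_measurable M b"
  shows "AE s in M. D (\<lambda>s. a s + b s) s = D a s + D b s"
proof -
  have "AE s in M. W (\<lambda>s. a s *\<^sub>C e + b s *\<^sub>C e) s = W (\<lambda>s. a s *\<^sub>C e) s + W (\<lambda>s. b s *\<^sub>C e) s"
    by (intro W_add bdd_weakly_measurable_scaleC assms bdd_weakly_measurable_const)
  then show ?thesis
    by eventually_elim (simp add: D_def scaleC_add_left blinfun.add_right)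
qed

lemma D_scale:
  assumes "bdd_measurable M a"
  shows "AE s in M. D (\<lambda>s. c * a s) s = c * D a s"
proof -
  have "AE s in M. W (\<lambda>s. c *\<^sub>C a s *\<^sub>C e) s = c *\<^sub>C W (\<lambda>s. a s *\<^sub>C e) s"
    by (intro W_scaleC bdd_weakly_measurable_scaleC assms bdd_weakly_measurable_const)
  then show ?thesis
    by eventually_elim (simp add: D_def scaleC_scaleC functional_scaleC[OF \<phi>])
qed

text \<open>
  Applied to a diagonal field \<open>g\<close> and the constant field \<open>x n\<close>, the identity \<open>W_apply\<close> becomes
  \<open>c n (W (x n)) + D (c n) (x n) = d g (x n) + g (W (x n))\<close>. The functional \<open>\<xi> n\<close> is an
  eigenvector of the adjoint of \<open>g\<close>, so the terms containing \<open>W\<close> cancel and \<open>D (c n)\<close> is the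
  \<open>n\<close>-th diagonal entry of \<open>d g\<close>. The coefficient \<open>c n\<close> can be small while \<open>D (c n)\<close> is a large
  multiple of \<open>D a\<close>.
\<close>

theorem D_eq_0:
  assumes a: "bdd_measurable M a"
  shows "AE s in M. s \<in> A \<longrightarrow> D a s = 0"
proof -
  obtain x :: "nat \<Rightarrow> 'a" and \<xi> where bi: "biorthogonal x \<xi>"
    using exists_biorthogonal[OF infinite_dimensional] by blast
  have \<xi>: "\<xi> n \<in> bounded_ops" "\<xi> n (x n) = 1" for n
    using bi by (auto simp: biorthogonal_def)
  define \<nu> where "\<nu> n = norm (x n) * norm (\<xi> n)" for n
  have \<nu>: "1 \<le> \<nu> n" for n
    using norm_blinfun[of "\<xi> n" "x n"] by (simp add: \<xi> \<nu>_def mult.commute)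
  \<comment> \<open>the precision that makes the \<open>n\<close>-th term of the diagonal series at most \<open>(1/2) ^ n\<close>, after
  multiplication by \<open>\<mu> n\<close> (one factor \<open>\<nu> n\<close>) and by the norm of \<open>rank_one (x n) (\<xi> n)\<close> (the other)\<close>
  define \<eta> where "\<eta> n = (1/2) ^ n / (real (Suc n) * \<nu> n * \<nu> n)" for n
  have \<eta>: "0 < \<eta> n" for n
    using \<nu>[of n] by (simp add: \<eta>_def)
  have "\<forall>n. \<exists>(r :: nat \<Rightarrow> complex) \<kappa>. \<kappa> \<in> M \<rightarrow>\<^sub>M count_space UNIV \<and>
      bdd_measurable M (\<lambda>s. r (\<kappa> s)) \<and> (\<forall>s. cmod (a s - r (\<kappa> s)) < \<eta> n)"
    using exists_countable_approximation_complex[OF a \<eta>] by blast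
  then obtain r :: "nat \<Rightarrow> nat \<Rightarrow> complex" and \<kappa> where \<kappa>: "\<And>n. \<kappa> n \<in> M \<rightarrow>\<^sub>M count_space UNIV"
    and r: "\<And>n. bdd_measurable M (\<lambda>s. r n (\<kappa> n s))"
    and close: "\<And>n s. cmod (a s - r n (\<kappa> n s)) < \<eta> n"
    by metis
  define \<mu> where "\<mu> n = complex_of_real (real (Suc n) * \<nu> n)" for n
  have cmod_\<mu>: "cmod (\<mu> n) = real (Suc n) * \<nu> n" for n
    unfolding \<mu>_def norm_of_real using \<nu>[of n] by simp
  define c where "c n s = \<mu> n * (a s + (- 1) * r n (\<kappa> n s))" for n s
  have c: "bdd_measurable M (c n)" for n
    unfolding c_def[abs_def] by (intro bdd_measurable_mult bdd_measurable_add bdd_measurable_const a r)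
  have Dc: "AE s in M. s \<in> A \<longrightarrow> D (c n) s = \<mu> n * D a s" for n
  proof -
    have r': "bdd_measurable M (\<lambda>s. (- 1) * r n (\<kappa> n s))"
      by (intro bdd_measurable_mult bdd_measurable_const r)
    show ?thesis
      using D_scale[OF bdd_measurable_add[OF a r'], of "\<mu> n"] D_add[OF a r'] D_scale[OF r, of "- 1" n]
        D_countably_valued[OF r[of n] \<kappa>[of n]]
      unfolding c_def[abs_def] by eventually_elim simp
  qed
  interpret diagonal_operator x \<xi> M c
  proof
    show "biorthogonal x \<xi>" by (rule bi)
    show "c n \<in> borel_measurable M" for n using c by (simp add: bdd_measurable_def)
    fix n s
    have "cmod (c n s) * \<nu> n = real (Suc n) * \<nu> n * \<nu> n * cmod (a s - r n (\<kappa> n s))"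
      by (simp add: c_def norm_mult cmod_\<mu> mult_ac del: of_nat_Suc)
    also have "\<dots> \<le> real (Suc n) * \<nu> n * \<nu> n * \<eta> n"
      using \<nu>[of n] less_imp_le[OF close] by (intro mult_left_mono) auto
    also have "\<dots> = (1/2) ^ n" using \<nu>[of n] by (simp add: \<eta>_def del: of_nat_Suc)
    finally show "cmod (c n s) * (norm (x n) * norm (\<xi> n)) \<le> (1/2) ^ n" by (simp add: \<nu>_def)
  qed
  define g where "g s = indicator A s *\<^sub>C diag s" for s
  have g: "g \<in> Fn"
    unfolding g_def[abs_def]
    using diag_wo_measurable norm_diag_le diag_approximable by (rule Fn_approximable)
  have g_le: "\<forall>s\<in>space M. norm (g s) \<le> 2"
    using norm_diag_le by (auto simp: g_def norm_scaleC indicator_def)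
  have main: "AE s in M. s \<in> A \<longrightarrow> D (c n) s = \<xi> n (d g s (x n))" for n
  proof -
    have xc: "bdd_weakly_measurable M (\<lambda>_. x n)" by (rule bdd_weakly_measurable_const)
    have cx: "bdd_weakly_measurable M (\<lambda>s. c n s *\<^sub>C x n)"
      by (intro bdd_weakly_measurable_scaleC c xc)
    have "AE s in M. s \<in> A \<longrightarrow> g s (x n) = c n s *\<^sub>C x n"
      using AE_space[of M] by eventually_elim (simp add: g_def scaleC_one diag_x)
    from W_cong[OF Fn_apply_bdd[OF g g_le xc] cx this] W_apply[OF g g_le xc] W_scalar_mult[OF c, of n "x n"]
      AE_space[of M]
    show ?thesis
    proof eventually_elim
      case (elim s)
      show ?case
      proof
        assume s: "s \<in> A"
        have "g s = diag s" using s by (simp add: g_def scaleC_one)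
        then have "c n s *\<^sub>C W (\<lambda>_. x n) s + D (c n) s *\<^sub>C x n = d g s (x n) + diag s (W (\<lambda>_. x n) s)"
          using elim s by simp
        then have "\<xi> n (c n s *\<^sub>C W (\<lambda>_. x n) s + D (c n) s *\<^sub>C x n) = \<xi> n (d g s (x n) + diag s (W (\<lambda>_. x n) s))"
          by simp
        then show "D (c n) s = \<xi> n (d g s (x n))"
          using elim(4) by (simp add: blinfun.add_right functional_scaleC \<xi> \<phi>_diag)
      qed
    qed
  qed
  have "AE s in M. \<forall>n. s \<in> A \<longrightarrow> \<mu> n * D a s = \<xi> n (d g s (x n))"
    unfolding AE_all_countable
  proof
    fix n show "AE s in M. s \<in> A \<longrightarrow> \<mu> n * D a s = \<xi> n (d g s (x n))"
      using main[of n] Dc[of n] by eventually_elim simp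
  qed
  then show ?thesis
  proof eventually_elim
    case (elim s)
    show ?case
    proof (rule impI, rule ccontr)
      assume s: "s \<in> A" and nz: "D a s \<noteq> 0"
      have "real (Suc n) * cmod (D a s) \<le> norm (d g s)" for n
      proof -
        have "real (Suc n) * \<nu> n * cmod (D a s) = cmod (\<mu> n * D a s)"
          by (simp add: cmod_\<mu> norm_mult)
        also have "\<dots> = cmod (\<xi> n (d g s (x n)))" using elim s by (simp only:)
        also have "\<dots> \<le> norm (\<xi> n) * norm (d g s (x n))" by (rule norm_blinfun)
        also have "\<dots> \<le> norm (\<xi> n) * (norm (d g s) * norm (x n))"
          by (intro mult_left_mono norm_blinfun) auto
        also have "\<dots> = \<nu> n * norm (d g s)" by (simp add: \<nu>_def mult_ac)
        finally have "\<nu> n * (real (Suc n) * cmod (D a s)) \<le> \<nu> n * norm (d g s)"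
          by (simp only: mult_ac)
        moreover have "0 < \<nu> n" using \<nu>[of n] by linarith
        ultimately show ?thesis by (rule mult_left_le_imp_le)
      qed
      then have bound: "real (Suc n) * cmod (D a s) \<le> norm (d g s)" for n .
      obtain n :: nat where n: "norm (d g s) < real n * cmod (D a s)"
        using nz ex_less_of_nat_mult[of "cmod (D a s)" "norm (d g s)"] by auto
      have "real n * cmod (D a s) \<le> real (Suc n) * cmod (D a s)"
        by (intro mult_right_mono) auto
      then show False using n bound[of n] by linarith
    qed
  qed
qed

lemma W_module:
  assumes b: "bdd_measurable M b"
  shows "AE s in M. s \<in> A \<longrightarrow> W (\<lambda>s. b s *\<^sub>C x) s = b s *\<^sub>C W (\<lambda>_. x) s"
  using W_scalar_mult[OF b, of x] D_eq_0[OF b] by eventually_elim simp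

text \<open>
  Insert \<open>f = \<chi>\<^sub>A (e \<otimes> \<eta>)\<close>, for which \<open>f y = \<eta>(y) e\<close> on \<open>A\<close>, and apply \<open>\<phi>\<close>; the term \<open>\<eta>(y) (W e)\<close>
  disappears by \<open>\<phi>_W_e\<close>. The right-hand side depends on \<open>y\<close> only through its value at \<open>s\<close>, which
  is the first sign that \<open>W\<close> is a pointwise operation.
\<close>

lemma functional_W:
  assumes y: "bdd_weakly_measurable M y" and \<eta>: "\<eta> \<in> bounded_ops"
  shows "AE s in M. s \<in> A \<longrightarrow> \<eta> (W y s) = - \<phi> (d (R (\<lambda>_. e) \<eta>) s (y s))"
proof -
  let ?f = "R (\<lambda>_. e) \<eta>"
  have f: "?f \<in> Fn" by (rule R_in_Fn[OF bdd_weakly_measurable_const \<eta>])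
  have bound: "\<forall>s\<in>space M. norm (?f s) \<le> norm e * norm \<eta>" by (simp add: norm_R_le)
  have b: "bdd_measurable M (\<lambda>s. \<eta> (y s))" by (rule bdd_measurable_functional[OF y \<eta>])
  have be: "bdd_weakly_measurable M (\<lambda>s. \<eta> (y s) *\<^sub>C e)"
    by (intro bdd_weakly_measurable_scaleC b bdd_weakly_measurable_const)
  have "AE s in M. s \<in> A \<longrightarrow> ?f s (y s) = \<eta> (y s) *\<^sub>C e"
    by (simp add: R_apply_in_A)
  from W_cong[OF Fn_apply_bdd[OF f bound y] be this] W_apply[OF f bound y] W_module[OF b, of e] \<phi>_W_e
  show ?thesis
  proof eventually_elim
    case (elim s)
    show ?case
    proof
      assume s: "s \<in> A"
      have "\<eta> (y s) *\<^sub>C W (\<lambda>_. e) s = d ?f s (y s) + \<eta> (W y s) *\<^sub>C e"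
        using elim s by (simp add: R_apply_in_A)
      then have "\<phi> (\<eta> (y s) *\<^sub>C W (\<lambda>_. e) s) = \<phi> (d ?f s (y s) + \<eta> (W y s) *\<^sub>C e)" by simp
      then have "0 = \<phi> (d ?f s (y s)) + \<eta> (W y s)"
        using elim s by (simp add: functional_scaleC[OF \<phi>] blinfun.add_right \<phi>_e)
      then show "\<eta> (W y s) = - \<phi> (d ?f s (y s))" by (metis add.inverse_unique)
    qed
  qed
qed

text \<open>
  The functional through which \<open>\<psi> j (W y s)\<close> depends on the vector \<open>y s\<close>, by \<open>\<psi>_W\<close>.
\<close>

definition l :: "nat \<Rightarrow> 's \<Rightarrow> 'a \<Rightarrow>\<^sub>L complex" where
  "l j s = - (\<phi> o\<^sub>L d (R (\<lambda>_. e) (\<psi> j)) s)"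

lemma l_apply: "l j s x = - \<phi> (d (R (\<lambda>_. e) (\<psi> j)) s x)"
  by (simp add: l_def blinfun.minus_left)

lemma \<psi>_W:
  assumes "bdd_weakly_measurable M y"
  shows "AE s in M. s \<in> A \<longrightarrow> (\<forall>j. \<psi> j (W y s) = l j s (y s))"
proof -
  have "AE s in M. \<forall>j. s \<in> A \<longrightarrow> \<psi> j (W y s) = l j s (y s)"
    unfolding l_apply by (intro AE_allI functional_W assms \<psi>_bounded_ops)
  then show ?thesis by eventually_elim simp
qed

text \<open>
  For the field \<open>y\<close> of the gliding hump, the numbers \<open>l j s (y s) = \<psi> j (W y s)\<close> are bounded by
  the norm of \<open>W y s\<close>.
\<close>

lemma l_bounded: "AE s in M. s \<in> A \<longrightarrow> (\<exists>C. \<forall>j. norm (l j s) \<le> C)"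
proof -
  have "(\<lambda>s. l j s x) \<in> borel_measurable M" for j x
    unfolding l_apply
    by (intro borel_measurable_uminus weakly_measurableD[OF _ \<phi>] wo_measurable_apply_const
        d_wo_measurable R_in_Fn bdd_weakly_measurable_const \<psi>_bounded_ops)
  from measurable_gliding_hump[of l M, OF this] obtain y where y: "weakly_measurable M y" "\<And>s. norm (y s) \<le> 1"
    and hump: "\<And>s C. (\<forall>j. cmod (l j s (y s)) \<le> C) \<Longrightarrow> \<exists>C'. \<forall>j. norm (l j s) \<le> C'"
    by blast
  have "bdd_weakly_measurable M y" using y by (auto simp: bdd_weakly_measurable_def)
  from \<psi>_W[OF this] show ?thesis
  proof eventually_elim
    case (elim s)
    show ?case
    proof
      assume "s \<in> A"
      then have "\<forall>j. cmod (l j s (y s)) \<le> norm (W y s)" using elim \<psi>_le by metis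
      then show "\<exists>C. \<forall>j. norm (l j s) \<le> C" by (rule hump)
    qed
  qed
qed

text \<open>
  At almost every point of \<open>A\<close> the functionals \<open>l j s\<close> are uniformly bounded and \<open>W (q k) s\<close> has
  \<open>\<psi> j\<close>-coordinates \<open>l j s (q k)\<close>, so that one operator realises all of them. It inherits
  measurability from \<open>W\<close>.
\<close>

lemma exists_pointwise_operator:
  "\<exists>w\<in>wo_measurable M. \<forall>y. bdd_weakly_measurable M y \<longrightarrow> (AE s in M. s \<in> A \<longrightarrow> w s (y s) = W y s)"
proof -
  define P where "P s T \<longleftrightarrow> T \<in> bounded_ops \<and> (\<forall>x j. \<psi> j (T x) = l j s x)" for s T
  define w where "w s = (if s \<in> A \<and> (\<exists>T. P s T) then SOME T. P s T else 0)" for s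
  have "AE s in M. \<forall>k. s \<in> A \<longrightarrow> (\<forall>j. \<psi> j (W (\<lambda>_. q k) s) = l j s (q k))"
    by (intro AE_allI \<psi>_W bdd_weakly_measurable_const)
  then have P_w: "AE s in M. s \<in> A \<longrightarrow> P s (w s)"
    using l_bounded AE_space[of M]
  proof eventually_elim
    case (elim s)
    show ?case
    proof
      assume s: "s \<in> A"
      obtain C where C: "\<And>j. norm (l j s) \<le> C" using elim s by blast
      have "l j s \<in> bounded_ops" for j
      proof -
        have "d (R (\<lambda>_. e) (\<psi> j)) s \<in> bounded_ops"
          using elim(3) by (intro wo_measurable_bounded_ops[OF d_wo_measurable] R_in_Fn
              bdd_weakly_measurable_const \<psi>_bounded_ops)
        then show ?thesis
          using \<phi> by (simp add: bounded_ops_def l_apply scaleC_complex_def)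
      qed
      then have "\<exists>T. P s T"
        using exists_operator_from_functionals[of "\<lambda>j. l j s" C] C elim s unfolding P_def by blast
      then show "P s (w s)" using s by (simp add: w_def someI_ex)
    qed
  qed
  have w_outside: "s \<notin> A \<Longrightarrow> w s = 0" for s by (simp add: w_def)
  have w_eq: "AE s in M. s \<in> A \<longrightarrow> w s (y s) = W y s" if y: "bdd_weakly_measurable M y" for y
    using P_w \<psi>_W[OF y]
    by eventually_elim (auto simp: P_def intro!: eq_of_norming)
  have "w \<in> wo_measurable M"
  proof (rule wo_measurableI)
    show "w s \<in> bounded_ops" for s
      by (auto simp: w_def P_def bounded_ops_0 intro: someI2_ex)
    fix x :: 'a
    have x: "bdd_weakly_measurable M (\<lambda>_. x)" by (rule bdd_weakly_measurable_const)
    show "weakly_measurable M (\<lambda>s. w s x)"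
    proof (rule weakly_measurable_cong_AE[OF complete])
      show "weakly_measurable M (\<lambda>s. indicator A s *\<^sub>C W (\<lambda>_. x) s)"
        using A by (intro weakly_measurable_scaleC W_measurable x) auto
      show "AE s in M. indicator A s *\<^sub>C W (\<lambda>_. x) s = w s x"
        using w_eq[OF x]
      proof eventually_elim
        case (elim s)
        then show ?case by (cases "s \<in> A") (simp_all add: scaleC_one w_outside)
      qed
    qed
  qed
  then show ?thesis using w_eq by blast
qed

text \<open>
  For bounded \<open>f\<close>, apply \<open>W_apply\<close> to the constant fields \<open>q k\<close>. In general \<open>f\<close> is cut off to the
  sets where its norm is at most \<open>n\<close>, which is harmless by locality.
\<close>

theorem derivation_inner_on:
  "\<exists>w\<in>wo_measurable M. \<forall>f\<in>Fn. AE s in M. s \<in> A \<longrightarrow> d f s = (w s o\<^sub>L f s) - (f s o\<^sub>L w s)"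
proof -
  obtain w where w: "w \<in> wo_measurable M"
    and w_eq: "\<And>y. bdd_weakly_measurable M y \<Longrightarrow> AE s in M. s \<in> A \<longrightarrow> w s (y s) = W y s"
    using exists_pointwise_operator by blast
  have bounded_case: "AE s in M. s \<in> A \<longrightarrow> d f s = (w s o\<^sub>L f s) - (f s o\<^sub>L w s)"
    if f: "f \<in> Fn" "\<forall>s\<in>space M. norm (f s) \<le> C" for f C
  proof -
    have "AE s in M. s \<in> A \<longrightarrow> d f s (q k) = w s (f s (q k)) - f s (w s (q k))" for k
    proof -
      have qk: "bdd_weakly_measurable M (\<lambda>_. q k)" by (rule bdd_weakly_measurable_const)
      show ?thesis
        using w_eq[OF qk] w_eq[OF Fn_apply_bdd[OF f qk]] W_apply[OF f qk]
        by eventually_elim simp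
    qed
    then have "AE s in M. \<forall>k. s \<in> A \<longrightarrow> d f s (q k) = w s (f s (q k)) - f s (w s (q k))"
      by (rule AE_allI)
    then show ?thesis
      by eventually_elim (auto intro!: blinfun_eq_of_dense simp: blinfun.diff_left)
  qed
  have "AE s in M. s \<in> A \<longrightarrow> d f s = (w s o\<^sub>L f s) - (f s o\<^sub>L w s)" if f: "f \<in> Fn" for f
  proof -
    have "AE s in M. norm (f s) \<le> real n \<longrightarrow> s \<in> A \<longrightarrow> d f s = (w s o\<^sub>L f s) - (f s o\<^sub>L w s)" for n
    proof -
      let ?B = "{s \<in> space M. norm (f s) \<le> real n}"
      have [measurable]: "(\<lambda>s. norm (f s)) \<in> borel_measurable M"
        by (rule norm_wo_measurable[OF Fn_wo_measurable[OF f]])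
      have B: "?B \<in> sets M" by measurable
      define g where "g s = indicator ?B s *\<^sub>C f s" for s
      have g: "g \<in> Fn" unfolding g_def[abs_def] by (intro Fn_scaleC bdd_measurable_indicator B f)
      have g_eq: "s \<in> ?B \<Longrightarrow> g s = f s" for s by (simp add: g_def scaleC_one)
      have g_le: "\<forall>s\<in>space M. norm (g s) \<le> real n"
        by (auto simp: g_def norm_scaleC indicator_def)
      have "AE s in M. s \<in> ?B \<longrightarrow> f s = g s" using g_eq by auto
      from d_local[OF f g B this] bounded_case[OF g g_le] AE_space[of M]
      show ?thesis by eventually_elim (use g_eq in auto)
    qed
    then have "AE s in M. \<forall>n::nat. norm (f s) \<le> real n \<longrightarrow> s \<in> A \<longrightarrow> d f s = (w s o\<^sub>L f s) - (f s o\<^sub>L w s)"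
      by (rule AE_allI)
    then show ?thesis
      by eventually_elim (use real_arch_simple in metis)
  qed
  then show ?thesis using w by blast
qed

end

section \<open>Innerness of derivations on admissible algebras\<close>

theorem corollary5p18:
  fixes M :: "'s measure"
    and U :: "('a::complex_banach \<Rightarrow>\<^sub>L 'a) set"
    and \<AA> :: "('s \<Rightarrow> 'a \<Rightarrow>\<^sub>L 'a) set set"
    and \<delta> :: "('s \<Rightarrow> 'a \<Rightarrow>\<^sub>L 'a) set \<Rightarrow> ('s \<Rightarrow> 'a \<Rightarrow>\<^sub>L 'a) set"
  assumes "infinite_dimensional TYPE('a)"
    and "separable_space (euclidean :: 'a topology)"
    and "complete_measure M"
    and "sigma_finite_measure M"
    and "closed_standard_algebra U"
    and "admissible M U \<AA>"
    and "wo_derivation M \<AA> \<delta>"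
  shows "\<exists>W\<in>L0_wo M bounded_ops. \<forall>F\<in>\<AA>. \<delta> F = wo_diff M (wo_mult M W F) (wo_mult M F W)"
proof -
  obtain q :: "nat \<Rightarrow> 'a" and \<psi> where "norming_sequence q \<psi>"
    using exists_norming_sequence[OF assms(2)] by blast
  then interpret norming_sequence q \<psi> .
  have "\<exists>e::'a. e \<noteq> 0"
  proof (rule ccontr)
    assume "\<not> ?thesis"
    then have "(UNIV :: 'a set) = {0}" by auto
    then have "complex_vector.span {} = (UNIV :: 'a set)" by simp
    then show False
      using assms(1) unfolding infinite_dimensional_def by blast
  qed
  then obtain e :: 'a where "e \<noteq> 0" by blast
  from exists_functional_eq_1[OF this] obtain \<phi> :: "'a \<Rightarrow>\<^sub>L complex" where \<phi>: "\<phi> \<in> bounded_ops" "\<phi> e = 1"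
    by blast

  have subalgebra: "wo_subalgebra M \<AA>"
    using assms(6) by (simp add: admissible_def)
  have \<AA>: "\<AA> \<subseteq> L0_wo M bounded_ops"
    using subalgebra by (simp add: wo_subalgebra_def)
  have \<AA>_add: "wo_add M F G \<in> \<AA>" if "F \<in> \<AA>" "G \<in> \<AA>" for F G
    using subalgebra that by (simp add: wo_subalgebra_def)
  have \<AA>_mult: "wo_mult M F G \<in> \<AA>" if "F \<in> \<AA>" "G \<in> \<AA>" for F G
    using subalgebra that by (simp add: wo_subalgebra_def)
  have \<AA>_smult: "wo_smult M G F \<in> \<AA>" if "G \<in> Linf M" "F \<in> \<AA>" for F G
    using assms(6) that by (simp add: admissible_def)
  have \<AA>_approx: "wo_smult M (char_class M A) F \<in> \<AA>"
    if "F \<in> Linf_wo M bounded_ops" "A \<in> sets M" "emeasure M A < \<infinity>"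
      "\<And>\<epsilon>::real. \<epsilon> > 0 \<Longrightarrow> \<exists>p\<in>finite_rank_idempotents.
          ess_norm M (wo_mult M F (wo_const M (id_blinfun - p))) \<le> ereal \<epsilon>" for F A
    using assms(6) that by (simp add: admissible_def)
  have \<delta>: "\<delta> F \<in> \<AA>" if "F \<in> \<AA>" for F
    using assms(7) that by (auto simp: wo_derivation_def)
  have \<delta>_add: "\<delta> (wo_add M F G) = wo_add M (\<delta> F) (\<delta> G)" if "F \<in> \<AA>" "G \<in> \<AA>" for F G
    using assms(7) that by (simp add: wo_derivation_def)
  have \<delta>_scale: "\<delta> (wo_scale M c F) = wo_scale M c (\<delta> F)" if "F \<in> \<AA>" for c F
    using assms(7) that by (simp add: wo_derivation_def)
  have \<delta>_mult: "\<delta> (wo_mult M F G) = wo_add M (wo_mult M (\<delta> F) G) (wo_mult M F (\<delta> G))"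
    if "F \<in> \<AA>" "G \<in> \<AA>" for F G
    using assms(7) that by (simp add: wo_derivation_def)

  define Fn where "Fn = {f \<in> wo_measurable M. wo_class M f \<in> \<AA>}"
  \<comment> \<open>the image is taken of the class, so \<open>d\<close> does not distinguish functions that agree almost everywhere\<close>
  define d where "d f = (SOME h. h \<in> wo_measurable M \<and> \<delta> (wo_class M f) = wo_class M h)" for f
  have Fn: "f \<in> wo_measurable M" "wo_class M f \<in> \<AA>" if "f \<in> Fn" for f
    using that by (auto simp: Fn_def)
  have d: "d f \<in> wo_measurable M \<and> \<delta> (wo_class M f) = wo_class M (d f)" if "f \<in> Fn" for f
  proof -
    have "\<delta> (wo_class M f) \<in> L0_wo M bounded_ops" using \<delta>[OF Fn(2)[OF that]] \<AA> by blast
    then have "\<exists>h. h \<in> wo_measurable M \<and> \<delta> (wo_class M f) = wo_class M h"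
      by (elim L0_wo_bounded_opsE) blast
    then show ?thesis unfolding d_def by (rule someI_ex)
  qed
  have d_wo: "d f \<in> wo_measurable M" and d_class: "\<delta> (wo_class M f) = wo_class M (d f)" if "f \<in> Fn" for f
    using d[OF that] by auto
  have d_AE: "AE s in M. d f s = h s"
    if "f \<in> Fn" "h \<in> wo_measurable M" "\<delta> (wo_class M f) = wo_class M h" for f h
    using that d[OF that(1)] wo_class_eq_iff by metis
  have FnI: "f \<in> Fn" if "f \<in> wo_measurable M" "wo_class M f \<in> \<AA>" for f
    using that by (simp add: Fn_def)
  have Fn_add: "(\<lambda>s. f s + g s) \<in> Fn" if f: "f \<in> Fn" and g: "g \<in> Fn" for f g
    using \<AA>_add[OF Fn(2)[OF f] Fn(2)[OF g]]
    unfolding wo_add_class[OF Fn(1)[OF f] Fn(1)[OF g]]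
    by (rule FnI[OF wo_measurable_add[OF Fn(1)[OF f] Fn(1)[OF g]]])
  have Fn_mult: "(\<lambda>s. f s o\<^sub>L g s) \<in> Fn" if f: "f \<in> Fn" and g: "g \<in> Fn" for f g
    using \<AA>_mult[OF Fn(2)[OF f] Fn(2)[OF g]]
    unfolding wo_mult_class[OF Fn(1)[OF f] Fn(1)[OF g]]
    by (rule FnI[OF wo_measurable_compose[OF Fn(1)[OF f] Fn(1)[OF g]]])
  have Fn_scaleC: "(\<lambda>s. a s *\<^sub>C f s) \<in> Fn" if bdd: "bdd_measurable M a" and f: "f \<in> Fn" for a f
  proof -
    obtain C where a: "a \<in> borel_measurable M" and C: "\<And>s. s \<in> space M \<Longrightarrow> cmod (a s) \<le> C"
      using bdd unfolding bdd_measurable_def by blast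
    have "L0_class M a \<in> Linf M"
      using a C by (rule bounded_in_Linf)
    from \<AA>_smult[OF this Fn(2)[OF f]] show ?thesis
      unfolding wo_smult_class[OF a Fn(1)[OF f]]
      by (rule FnI[OF wo_measurable_scaleC[OF a Fn(1)[OF f]]])
  qed
  have Fn_approximable: "(\<lambda>s. indicator A s *\<^sub>C f s) \<in> Fn"
    if A: "A \<in> sets M" "emeasure M A < \<infinity>" and f: "f \<in> wo_measurable M"
      and C: "\<And>s. s \<in> space M \<Longrightarrow> norm (f s) \<le> C"
      and approx: "\<And>\<epsilon>. 0 < \<epsilon> \<Longrightarrow>
        \<exists>p\<in>finite_rank_idempotents. \<forall>s\<in>space M. norm (f s o\<^sub>L (id_blinfun - p)) \<le> \<epsilon>" for A f C
  proof -
    have "wo_smult M (char_class M A) (wo_class M f) \<in> \<AA>"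
    proof (rule \<AA>_approx[OF bounded_in_Linf_wo[OF f C] A])
      fix \<epsilon> :: real assume "0 < \<epsilon>"
      then obtain p where p: "p \<in> finite_rank_idempotents"
        "\<And>s. s \<in> space M \<Longrightarrow> norm (f s o\<^sub>L (id_blinfun - p)) \<le> \<epsilon>"
        using approx by blast
      have c: "(\<lambda>_. id_blinfun - p) \<in> wo_measurable M"
        using p(1) by (intro wo_measurable_const bounded_ops_diff bounded_ops_id)
          (simp add: finite_rank_idempotents_def finite_rank_ops_def)
      have "ess_norm M (wo_mult M (wo_class M f) (wo_const M (id_blinfun - p))) \<le> ereal \<epsilon>"
        unfolding wo_const_def wo_mult_class[OF f c]
        by (rule ess_norm_wo_class_le[OF wo_measurable_compose[OF f c] p(2)])
      then show "\<exists>p\<in>finite_rank_idempotents.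
          ess_norm M (wo_mult M (wo_class M f) (wo_const M (id_blinfun - p))) \<le> ereal \<epsilon>"
        using p(1) by blast
    qed
    moreover have ind: "indicator A \<in> borel_measurable M" using A(1) by simp
    ultimately show ?thesis
      unfolding char_class_def wo_smult_class[OF ind f]
      by (intro FnI wo_measurable_scaleC ind f)
  qed
  have derivation: "function_derivation q \<psi> M A Fn d e \<phi>"
    if A: "A \<in> sets M" "emeasure M A < \<infinity>" for A
  proof (intro function_derivation.intro function_derivation_axioms.intro)
    show "norming_sequence q \<psi>" by (rule norming_sequence_axioms)
    show "(\<lambda>s. indicator A s *\<^sub>C f s) \<in> Fn"
      if "f \<in> wo_measurable M" "\<And>s. s \<in> space M \<Longrightarrow> norm (f s) \<le> C"
        "\<And>\<epsilon>. 0 < \<epsilon> \<Longrightarrow>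
          \<exists>p\<in>finite_rank_idempotents. \<forall>s\<in>space M. norm (f s o\<^sub>L (id_blinfun - p)) \<le> \<epsilon>" for f C
      by (rule Fn_approximable[OF A that])
    show "AE s in M. d f s = d g s" if "f \<in> Fn" "g \<in> Fn" "AE s in M. f s = g s" for f g
    proof (rule d_AE[OF that(1) d_wo[OF that(2)]])
      have "wo_class M f = wo_class M g" using that Fn by (simp add: wo_class_eq_iff)
      then show "\<delta> (wo_class M f) = wo_class M (d g)" using d_class[OF that(2)] by simp
    qed
    show "AE s in M. d (\<lambda>s. f s + g s) s = d f s + d g s" if "f \<in> Fn" "g \<in> Fn" for f g
      using that Fn[OF that(1)] Fn[OF that(2)] \<delta>_add[OF Fn(2)[OF that(1)] Fn(2)[OF that(2)]]
      by (intro d_AE Fn_add wo_measurable_add d_wo) (simp_all add: wo_add_class d_class d_wo)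
    show "AE s in M. d (\<lambda>s. c *\<^sub>C f s) s = c *\<^sub>C d f s" if "f \<in> Fn" for f c
      using that Fn[OF that] \<delta>_scale[OF Fn(2)[OF that]]
      by (intro d_AE Fn_scaleC bdd_measurable_const wo_measurable_scaleC d_wo)
         (simp_all add: wo_scale_class d_class d_wo)
    show "AE s in M. d (\<lambda>s. f s o\<^sub>L g s) s = (d f s o\<^sub>L g s) + (f s o\<^sub>L d g s)"
      if "f \<in> Fn" "g \<in> Fn" for f g
      using that Fn[OF that(1)] Fn[OF that(2)] \<delta>_mult[OF Fn(2)[OF that(1)] Fn(2)[OF that(2)]]
      by (intro d_AE Fn_mult wo_measurable_add wo_measurable_compose d_wo)
         (simp_all add: wo_add_class wo_mult_class d_class d_wo wo_measurable_compose)
  qed (rule assms(1,3) A(1) \<phi> | (rule Fn(1) d_wo Fn_add Fn_mult Fn_scaleC; assumption))+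

  obtain A :: "nat \<Rightarrow> 's set" where "range A \<subseteq> sets M" and A_space: "(\<Union>i. A i) = space M"
      and A_fin: "\<And>i. emeasure M (A i) \<noteq> \<infinity>"
    by (rule sigma_finite_measure.sigma_finite[OF assms(4)]) blast
  then have A: "A i \<in> sets M" "emeasure M (A i) < \<infinity>" for i
    by (auto simp: less_top)
  have "\<exists>w\<in>wo_measurable M. \<forall>f\<in>Fn. AE s in M. s \<in> A i \<longrightarrow> d f s = (w s o\<^sub>L f s) - (f s o\<^sub>L w s)" for i
    by (rule function_derivation.derivation_inner_on[OF derivation[OF A]])
  then have "\<forall>i. \<exists>w. w \<in> wo_measurable M \<and>
      (\<forall>f\<in>Fn. AE s in M. s \<in> A i \<longrightarrow> d f s = (w s o\<^sub>L f s) - (f s o\<^sub>L w s))"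
    by blast
  from choice[OF this] obtain w where w: "\<And>i. w i \<in> wo_measurable M"
    and inner: "\<And>i f. f \<in> Fn \<Longrightarrow> AE s in M. s \<in> A i \<longrightarrow> d f s = (w i s o\<^sub>L f s) - (f s o\<^sub>L w i s)"
    by blast
  \<comment> \<open>gluing: at \<open>s\<close> use the operator of the first set of the cover that contains \<open>s\<close>\<close>
  define \<iota> where "\<iota> s = (LEAST i. s \<in> A i)" for s
  define v where "v s = w (\<iota> s) s" for s
  have \<iota>: "s \<in> A (\<iota> s)" if "s \<in> space M" for s
  proof -
    have "\<exists>i. s \<in> A i" using that unfolding A_space[symmetric] by simp
    then show ?thesis unfolding \<iota>_def by (rule LeastI_ex)
  qed
  have \<iota>_measurable: "\<iota> \<in> M \<rightarrow>\<^sub>M count_space UNIV"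
  proof -
    have "{s \<in> space M. s \<in> A i} = A i" for i
      using sets.sets_into_space[OF A(1)[of i]] by blast
    then have "Measurable.pred M (\<lambda>s. s \<in> A i)" for i
      unfolding pred_def using A(1)[of i] by simp
    then show ?thesis unfolding \<iota>_def by (rule measurable_Least)
  qed
  have v: "v \<in> wo_measurable M"
  proof (rule wo_measurableI)
    show "v s \<in> bounded_ops" if "s \<in> space M" for s
      unfolding v_def by (rule wo_measurable_bounded_ops[OF w that])
    show "weakly_measurable M (\<lambda>s. v s x)" for x
      unfolding v_def by (rule weakly_measurable_countable[OF wo_measurable_apply_const[OF w] \<iota>_measurable])
  qed
  have v_inner: "AE s in M. d f s = (v s o\<^sub>L f s) - (f s o\<^sub>L v s)" if "f \<in> Fn" for f
  proof -
    have "AE s in M. \<forall>i. s \<in> A i \<longrightarrow> d f s = (w i s o\<^sub>L f s) - (f s o\<^sub>L w i s)"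
      by (intro AE_allI inner that)
    then show ?thesis
      using AE_space[of M] by eventually_elim (simp add: v_def \<iota>)
  qed
  have "\<delta> F = wo_diff M (wo_mult M (wo_class M v) F) (wo_mult M F (wo_class M v))" if F: "F \<in> \<AA>" for F
  proof -
    obtain f where f: "f \<in> wo_measurable M" "F = wo_class M f"
      using F \<AA> by (blast elim: L0_wo_bounded_opsE)
    then have fFn: "f \<in> Fn" using F by (simp add: Fn_def)
    have "\<delta> F = wo_class M (d f)" using d_class[OF fFn] f(2) by simp
    also have "\<dots> = wo_class M (\<lambda>s. (v s o\<^sub>L f s) - (f s o\<^sub>L v s))"
      using v_inner[OF fFn] f(1) v d_wo[OF fFn]
      by (simp add: wo_class_eq_iff wo_measurable_diff wo_measurable_compose)
    also have "\<dots> = wo_diff M (wo_mult M (wo_class M v) F) (wo_mult M F (wo_class M v))"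
      using f v by (simp add: wo_mult_class wo_diff_class wo_measurable_compose)
    finally show ?thesis .
  qed
  then show ?thesis using wo_class_in_L0_wo[OF v] by blast
qed

end
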